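(* Let $0<\alpha<1$, let $n\ge2$ be an integer, and consider $$(P_{\lambda,n})\qquad -u''=\lambda u+m_n(x)u^\alpha\ \text{ in }(-1,1),\qquad u(-1)=u(1)=0 .$$ Define $$\lambda_{c,n}:=\frac{\pi^2}{\big((1-\alpha)+\frac{1+\alpha}{n}\big)^2},\qquad \lambda_n^*:=\Big(\frac{n\pi}{2}\Big)^2 .$$ Then $\frac{\pi^2}{4}<\lambda_{c,n}<\lambda_n^*$. At $\lambda=\lambda_{c,n}$ there exists an even positive flat solution $u_{c,n}$ of $(P_{\lambda,n})$, i.e. $u_{c,n}>0$ in $(-1,1)$ and $u_{c,n}(\pm1)=u_{c,n}'(\pm1)=0$. For every $\lambda\in(\lambda_{c,n},\lambda_n^* )$ there exists a unique even non-negative solution $u_{\lambda,n}$ of $(P_{\lambda,n})$ whose (connected) support is $$\operatorname{supp}u_{\lambda,n}=[-b_{\lambda,n},b_{\lambda,n}]\Subset(-1,1),\qquad b_{\lambda,n}=\frac1{1-\alpha}\Big(\frac{\pi}{\sqrt\lambda}-\frac{1+\alpha}{n}\Big).$$ For $x\ge0$ it is given by $$u_{\lambda,n}(x)=\begin{cases}A_{\lambda,n}\cos(\sqrt\lambda\,x),&0\le x\le\frac1n,\\[1mm]\Big(\frac{2}{(1+\alpha)\lambda}\Big)^{\frac1{1-\alpha}}\sin^{\frac2{1-\alpha}}\Big[\frac{1-\alpha}{2}\sqrt\lambda\,(b_{\lambda,n}-x)\Big],&\frac1n\le x\le b_{\lambda,n},\\[1mm]0,&b_{\lambda,n}\le x\le1,\end{cases}$$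 extended evenly to $(-1,0)$. Moreover, $$A_{\lambda,n}=\|u_{\lambda,n}\|_{L^\infty(-1,1)}=\Big(\frac{2}{(1+\alpha)\lambda}\Big)^{\frac1{1-\alpha}}\cos^{\frac{1+\alpha}{1-\alpha}}\Big(\frac{\sqrt\lambda}{n}\Big).$$ For each fixed $n$, the map $\lambda\mapsto A_{\lambda,n}$ is strictly decreasing on $(\lambda_{c,n},\lambda_n^* )$, and $A_{\lambda,n}\to0$ as $\lambda\uparrow\lambda_n^*$. If $A_n:=\|u_{c,n}\|_{L^\infty(-1,1)}$, then $$A_n=\Big[\frac{2}{(1+\alpha)\pi^2}\Big((1-\alpha)+\frac{1+\alpha}{n}\Big)^2\Big]^{\frac1{1-\alpha}}\cos^{\frac{1+\alpha}{1-\alpha}}\Big(\frac{\pi}{n(1-\alpha)+(1+\alpha)}\Big).$$ As $n\to\infty$, $$\lambda_{c,n}\uparrow\frac{\pi^2}{(1-\alpha)^2},\qquad A_n\to\Big[\frac{2(1-\alpha)^2}{(1+\alpha)\pi^2}\Big]^{\frac1{1-\alpha}}>0,\qquad \frac{\lambda_{c,n}}{\lambda_n^*}\to0 .$$ Finally, for $\lambda\in(\lambda_{c,n},\lambda_n^* )$, $H_\lambda(u_{\lambda,n})=M_n(u_{\lambda,n})<0$, and therefore $E_\lambda(u_{\lambda,n})>0$ and $E_\lambda''(u_{\lambda,n})<0$.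
   Context: The weight is $m_n(x)=0$ for $|x|<1/n$ and $m_n(x)=-1$ for $1/n\le|x|<1$. Solutions are weak solutions in $H_0^1(-1,1)$ (hence $C^1$ on $[-1,1]$). $H_\lambda(u)=\int_{-1}^1(|u'|^2-\lambda u^2)\,dx$, $M_n(u)=\int_{-1}^1m_n|u|^{\alpha+1}\,dx$, $E_\lambda(u)=\frac12H_\lambda(u)-\frac1{\alpha+1}M_n(u)$, $E_\lambda''(u):=H_\lambda(u)-\alpha M_n(u)$. *)

theory Defs
  imports "HOL-Analysis.Analysis" "HOL-Probability.Essential_Supremum"
begin

section \<open>The Sobolev space \<open>H\<^sup>1\<^sub>0(-1,1)\<close>\<close>

abbreviation Om :: "real measure" where
  "Om \<equiv> lebesgue_on {-1<..<1}"

definition L2 :: "(real \<Rightarrow> real) set" where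
  "L2 = {f. f \<in> borel_measurable Om \<and> integrable Om (\<lambda>x. (f x)\<^sup>2)}"

text \<open>
  Test functions are of class \<open>C\<^sup>1\<close> with compact support in \<open>(-1,1)\<close>, extended by zero to the line.
  This is the convention of Brezis (Functional Analysis, Sobolev Spaces and Partial Differential
  Equations, Section 8.2); it yields the same Sobolev spaces as smooth test functions.
\<close>

definition C1c :: "(real \<Rightarrow> real) set" where
  "C1c = {\<phi>. \<phi> C1_differentiable_on UNIV \<and>
             (\<exists>K. compact K \<and> K \<subseteq> {-1<..<1} \<and> (\<forall>x. x \<notin> K \<longrightarrow> \<phi> x = 0))}"

definition weak_derivative :: "(real \<Rightarrow> real) \<Rightarrow> (real \<Rightarrow> real) \<Rightarrow> bool" where
  "weak_derivative u g \<longleftrightarrow>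
     (\<forall>\<phi>\<in>C1c. (\<integral>x. u x * deriv \<phi> x \<partial>Om) = - (\<integral>x. g x * \<phi> x \<partial>Om))"

definition H1 :: "(real \<Rightarrow> real) set" where
  "H1 = {u \<in> L2. \<exists>g\<in>L2. weak_derivative u g}"

text \<open>Elements of \<open>L2\<close> and \<open>H1\<close> are functions, not classes; the weak derivative is determined
  only almost everywhere, and \<open>wderiv\<close> picks an arbitrary representative of it.\<close>

definition wderiv :: "(real \<Rightarrow> real) \<Rightarrow> real \<Rightarrow> real" where
  "wderiv u = (SOME g. g \<in> L2 \<and> weak_derivative u g)"

definition H1_norm :: "(real \<Rightarrow> real) \<Rightarrow> real" where
  "H1_norm u = sqrt ((\<integral>x. (u x)\<^sup>2 \<partial>Om) + (\<integral>x. (wderiv u x)\<^sup>2 \<partial>Om))"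

definition H10 :: "(real \<Rightarrow> real) set" where
  "H10 = {u \<in> H1. \<exists>\<phi>::nat \<Rightarrow> real \<Rightarrow> real. (\<forall>k. \<phi> k \<in> C1c) \<and>
            (\<lambda>k. H1_norm (\<lambda>x. u x - \<phi> k x)) \<longlonglongrightarrow> 0}"

text \<open>The conversion to \<open>real\<close> sends an infinite essential supremum to \<open>0\<close>, so the definition is
  meaningful for essentially bounded functions only.\<close>

definition Linf_norm :: "(real \<Rightarrow> real) \<Rightarrow> real" where
  "Linf_norm u = real_of_ereal (esssup Om (\<lambda>x. ereal \<bar>u x\<bar>))"


section \<open>The boundary value problem\<close>

definition m_weight :: "nat \<Rightarrow> real \<Rightarrow> real" where
  "m_weight n x = (if \<bar>x\<bar> < 1 / real n then 0 else -1)"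

text \<open>
  A non-negative weak solution, given by its continuous representative on \<open>[-1,1]\<close>; the values
  outside \<open>[-1,1]\<close> are irrelevant. The boundary condition is membership in \<open>H\<^sup>1\<^sub>0(-1,1)\<close>.
  Non-negativity is what gives \<open>u\<^sup>\<alpha>\<close> its meaning; note that \<open>0 powr \<alpha> = 0\<close>.
\<close>

definition nonneg_solution :: "real \<Rightarrow> nat \<Rightarrow> real \<Rightarrow> (real \<Rightarrow> real) \<Rightarrow> bool" where
  "nonneg_solution \<alpha> n lam u \<longleftrightarrow>
     u \<in> H10 \<and> continuous_on {-1..1} u \<and> (\<forall>x\<in>{-1..1}. 0 \<le> u x) \<and>
     (\<forall>v\<in>H10. (\<integral>x. wderiv u x * wderiv v x \<partial>Om) =
                (\<integral>x. (lam * u x + m_weight n x * u x powr \<alpha>) * v x \<partial>Om))"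

definition even_on_interval :: "(real \<Rightarrow> real) \<Rightarrow> bool" where
  "even_on_interval u \<longleftrightarrow> (\<forall>x\<in>{-1..1}. u (- x) = u x)"

definition supp :: "(real \<Rightarrow> real) \<Rightarrow> real set" where
  "supp u = closure {x \<in> {-1<..<1}. u x \<noteq> 0}"

text \<open>The derivatives at the end points are one-sided.\<close>

definition positive_flat :: "(real \<Rightarrow> real) \<Rightarrow> bool" where
  "positive_flat u \<longleftrightarrow>
     (\<forall>x\<in>{-1<..<1}. 0 < u x) \<and> u (-1) = 0 \<and> u 1 = 0 \<and>
     (u has_real_derivative 0) (at (-1) within {-1..1}) \<and>
     (u has_real_derivative 0) (at 1 within {-1..1})"

definition lam_c :: "real \<Rightarrow> nat \<Rightarrow> real" where
  "lam_c \<alpha> n = pi\<^sup>2 / ((1 - \<alpha>) + (1 + \<alpha>) / real n)\<^sup>2"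

definition lam_star :: "nat \<Rightarrow> real" where
  "lam_star n = (real n * pi / 2)\<^sup>2"

definition b_end :: "real \<Rightarrow> nat \<Rightarrow> real \<Rightarrow> real" where
  "b_end \<alpha> n lam = 1 / (1 - \<alpha>) * (pi / sqrt lam - (1 + \<alpha>) / real n)"


section \<open>The functionals\<close>

definition H :: "real \<Rightarrow> (real \<Rightarrow> real) \<Rightarrow> real" where
  "H lam u = (\<integral>x. (\<bar>wderiv u x\<bar>\<^sup>2 - lam * (u x)\<^sup>2) \<partial>Om)"

definition M :: "real \<Rightarrow> nat \<Rightarrow> (real \<Rightarrow> real) \<Rightarrow> real" where
  "M \<alpha> n u = (\<integral>x. m_weight n x * \<bar>u x\<bar> powr (\<alpha> + 1) \<partial>Om)"

definition E :: "real \<Rightarrow> nat \<Rightarrow> real \<Rightarrow> (real \<Rightarrow> real) \<Rightarrow> real" where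
  "E \<alpha> n lam u = 1 / 2 * H lam u - 1 / (\<alpha> + 1) * M \<alpha> n u"

definition E'' :: "real \<Rightarrow> nat \<Rightarrow> real \<Rightarrow> (real \<Rightarrow> real) \<Rightarrow> real" where
  "E'' \<alpha> n lam u = H lam u - \<alpha> * M \<alpha> n u"

end

theory Submission
  imports Defs
begin

text \<open>
  The profile is glued at \<open>1/n\<close> from a multiple of \<open>cos (\<surd>\<lambda> x)\<close>, which solves the linear equation, and the
  zero-energy solution of \<open>-v'' = \<lambda> v - v\<^bsup>\<alpha>\<^esup>\<close> that vanishes to second order at \<open>b\<close>. It is of class \<open>C\<^sup>1\<close>
  on the line, and extension by zero together with \<open>b \<le> 1\<close> puts it in \<open>H\<^sup>1\<^sub>0\<close>; integrating by parts
  makes it a weak solution.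

  For uniqueness, the lemma of du Bois-Reymond turns a weak solution into a \<open>C\<^sup>1\<close> one. Evenness forces it to
  be \<open>B cos (\<surd>\<lambda> x)\<close> on \<open>[0,1/n]\<close>. Its energy vanishes beyond \<open>b\<close> and is conserved down to \<open>1/n\<close>, and this
  determines \<open>B\<close>. From \<open>1/n\<close> on, the two solutions share their initial data, and the nonlinearity
  is Lipschitz as long as the explicit one is positive, that is, up to \<open>b\<close>. Testing the equation with the
  solution itself gives \<open>H = M\<close>.
\<close>

section \<open>Square-integrable functions and test functions\<close>

text \<open>The obstacle is that \<open>t powr \<alpha>\<close> is not Lipschitz at 0. This is what
  lets a solution reach 0 with zero slope at b and stay there; for the same reason the vanishing
  Cauchy data at b do not determine a solution. Uniqueness therefore fixes the support, and only the
  conserved energy carries information from b back to 1/n.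

  Origin of the constants: zero energy means v'^2 = 2/(1+\<alpha>) v^(1+\<alpha>) - \<lambda> v^2,
  which integrates to a power of the sine of \<kappa> (b - x), with \<omega> the square root of
  \<lambda> and \<kappa> = (1-\<alpha>) \<omega> / 2. Matching logarithmic derivatives at 1/n asks
  that the cotangent of \<kappa> (b - 1/n) equal the tangent of \<omega>/n, that is, \<kappa> (b -
  1/n) + \<omega>/n = pi/2. Solved for b, this is \<open>b_end\<close>. The value
  \<open>lam_c\<close> is where b = 1, and \<open>lam_star\<close> is where \<omega>/n = pi/2, so
  that b would shrink to 1/n.\<close>

lemma space_Om: "space Om = {-1<..<1}"
  by simp

lemma finite_measure_Om: "finite_measure Om"
  by (rule finite_measureI) (simp add: emeasure_restrict_space)

lemma integrable_Om_bounded: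
  assumes "f \<in> borel_measurable Om" and "\<And>x. x \<in> {-1<..<1} \<Longrightarrow> \<bar>f x\<bar> \<le> B"
  shows "integrable Om (f :: real \<Rightarrow> real)"
proof (rule finite_measure.integrable_const_bound[OF finite_measure_Om, where B = B])
  show "AE x in Om. norm (f x) \<le> B"
    by (rule AE_I2) (simp only: space_Om real_norm_def assms(2))
qed (rule assms(1))

lemma measurable_Om_borel:
  assumes "f \<in> borel_measurable borel"
  shows "(f :: real \<Rightarrow> real) \<in> borel_measurable Om"
  by (rule measurable_restrict_space1) (simp add: assms measurable_completion)

lemma continuous_measurable_Om:
  "continuous_on UNIV f \<Longrightarrow> (f :: real \<Rightarrow> real) \<in> borel_measurable Om"
  by (intro measurable_Om_borel borel_measurable_continuous_onI)

lemma L2_measurable: "f \<in> L2 \<Longrightarrow> f \<in> borel_measurable Om"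
  by (simp add: L2_def)

lemma L2_bounded:
  assumes "f \<in> borel_measurable Om" and B: "\<And>x. x \<in> {-1<..<1} \<Longrightarrow> \<bar>f x\<bar> \<le> B"
  shows "f \<in> L2"
proof -
  have "\<bar>(f x)\<^sup>2\<bar> \<le> B\<^sup>2" if "x \<in> {-1<..<1}" for x
    using B[OF that] by (simp add: abs_le_square_iff[symmetric])
  then have "integrable Om (\<lambda>x. (f x)\<^sup>2)"
    by (intro integrable_Om_bounded[where B = "B\<^sup>2"] borel_measurable_power assms(1))
  then show ?thesis using assms(1) by (simp add: L2_def)
qed

lemma L2_mult_integrable:
  assumes "f \<in> L2" "g \<in> L2"
  shows "integrable Om (\<lambda>x. f x * g x)"
proof (rule Bochner_Integration.integrable_bound[where f = "\<lambda>x. (f x)\<^sup>2 + (g x)\<^sup>2"])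
  show "AE x in Om. norm (f x * g x) \<le> norm ((f x)\<^sup>2 + (g x)\<^sup>2)"
  proof (rule AE_I2)
    fix x
    have "\<bar>f x\<bar> * \<bar>g x\<bar> \<le> (f x)\<^sup>2 + (g x)\<^sup>2"
      using sum_squares_bound[of "\<bar>f x\<bar>" "\<bar>g x\<bar>"] mult_nonneg_nonneg[of "\<bar>f x\<bar>" "\<bar>g x\<bar>"]
      unfolding power2_abs by linarith
    then show "norm (f x * g x) \<le> norm ((f x)\<^sup>2 + (g x)\<^sup>2)"
      by (simp add: abs_mult)
  qed
qed (use assms in \<open>auto simp: L2_def\<close>)

lemma L2_const: "(\<lambda>_. c) \<in> L2"
  by (rule L2_bounded[where B = "\<bar>c\<bar>"]) auto

lemma L2_integrable: "f \<in> L2 \<Longrightarrow> integrable Om f"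
  using L2_mult_integrable[OF _ L2_const[of 1]] by simp

lemma L2_cmult: "f \<in> L2 \<Longrightarrow> (\<lambda>x. c * f x) \<in> L2"
  by (auto simp: L2_def power_mult_distrib)

lemma L2_add:
  assumes "f \<in> L2" "g \<in> L2"
  shows "(\<lambda>x. f x + g x) \<in> L2"
proof -
  have "integrable Om (\<lambda>x. (f x)\<^sup>2 + (g x)\<^sup>2 + 2 * (f x * g x))"
    using assms L2_mult_integrable[OF assms] by (auto simp: L2_def)
  moreover have "(\<lambda>x. f x + g x) \<in> borel_measurable Om"
    by (intro borel_measurable_add L2_measurable assms)
  ultimately show ?thesis by (simp add: L2_def power2_sum mult.assoc)
qed

lemma L2_diff:
  assumes "f \<in> L2" "g \<in> L2"
  shows "(\<lambda>x. f x - g x) \<in> L2"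
  using L2_add[OF assms(1) L2_cmult[OF assms(2), of "-1"]] by simp

lemma continuous_L2:
  assumes "continuous_on {-1..1} (f :: real \<Rightarrow> real)"
  shows "f \<in> L2"
proof -
  obtain B where "\<And>x. x \<in> {-1..1::real} \<Longrightarrow> norm (f x) \<le> B"
    using compact_imp_bounded[OF compact_continuous_image[OF assms(1)]]
    unfolding bounded_iff by blast
  then show ?thesis proof (intro L2_bounded[where B = B])
    show "f \<in> borel_measurable Om"
      by (intro continuous_imp_measurable_on_sets_lebesgue continuous_on_subset[OF assms]) auto
  qed (simp add: less_imp_le)
qed

section \<open>Test functions and cut-offs of class C1\<close>

lemma C1cI:
  assumes "\<And>x. (\<phi> has_real_derivative \<phi>' x) (at x)" "continuous_on UNIV \<phi>'"
    and "compact K" "K \<subseteq> {-1<..<1}" "\<And>x. x \<notin> K \<Longrightarrow> \<phi> x = 0"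
  shows "\<phi> \<in> C1c"
  using assms unfolding C1c_def C1_differentiable_on_def
  by (auto simp: has_real_derivative_iff_has_vector_derivative)

lemma C1cD:
  assumes "\<phi> \<in> C1c"
  shows "(\<phi> has_real_derivative deriv \<phi> x) (at x)" and "continuous_on UNIV (deriv \<phi>)"
    and "continuous_on UNIV \<phi>" and "\<bar>x\<bar> \<ge> 1 \<Longrightarrow> \<phi> x = 0"
proof -
  obtain D where D: "\<And>x. (\<phi> has_real_derivative D x) (at x)" "continuous_on UNIV D"
    using assms unfolding C1c_def C1_differentiable_on_def
    by (auto simp: has_real_derivative_iff_has_vector_derivative)
  then have "deriv \<phi> = D" using DERIV_imp_deriv by blast
  then show "(\<phi> has_real_derivative deriv \<phi> x) (at x)" "continuous_on UNIV (deriv \<phi>)"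
    using D by auto
  show "continuous_on UNIV \<phi>"
    using D(1) DERIV_isCont continuous_at_imp_continuous_on by blast
  show "\<bar>x\<bar> \<ge> 1 \<Longrightarrow> \<phi> x = 0"
    using assms unfolding C1c_def by fastforce
qed

lemma C1c_L2: "\<phi> \<in> C1c \<Longrightarrow> \<phi> \<in> L2" and C1c_deriv_L2: "\<phi> \<in> C1c \<Longrightarrow> deriv \<phi> \<in> L2"
  by (metis C1cD(2,3) continuous_L2 continuous_on_subset subset_UNIV)+

text \<open>Squaring removes the corner of the positive part, so that cut-offs of class C1 can be
  built by algebra alone.\<close>

lemma DERIV_max0_square: "((\<lambda>t. (max 0 t)\<^sup>2) has_real_derivative 2 * max 0 t) (at (t :: real))"
proof -
  consider "t < 0" | "t > 0" | "t = 0" by linarith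
  then show ?thesis
  proof cases
    case 1
    have "((\<lambda>t. 0) has_real_derivative 0) (at t)" by simp
    then show ?thesis using 1
      by (auto intro: has_field_derivative_transform_within_open[of "\<lambda>_. 0" _ _ "{..<0}"])
  next
    case 2
    have "((\<lambda>t. t\<^sup>2) has_real_derivative 2 * t) (at t)"
      by (auto intro!: derivative_eq_intros)
    then show ?thesis using 2
      by (auto intro: has_field_derivative_transform_within_open[of "\<lambda>t. t\<^sup>2" _ _ "{0<..}"])
  next
    case 3
    have "(\<lambda>h :: real. (max 0 h)\<^sup>2 / h) \<midarrow>0\<rightarrow> 0"
    proof (rule Lim_null_comparison[where g = "\<lambda>h. \<bar>h\<bar>"])
      show "\<forall>\<^sub>F h in at 0. norm ((max 0 h)\<^sup>2 / h) \<le> \<bar>h\<bar>"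
        by (rule always_eventually) (auto simp: max_def power2_eq_square)
    qed (auto intro!: tendsto_eq_intros)
    then show ?thesis using 3 by (simp add: DERIV_def)
  qed
qed

text \<open>The test functions \<open>k\<^sup>3 r / (1 + k\<^sup>3 r)\<close> with \<open>r = (max 0 ((x - a) (b - x) - 1/k))\<^sup>2\<close> converge
  boundedly to the indicator of \<open>(a,b)\<close>.\<close>

lemma ex_C1c_tendsto_indicator:
  assumes "-1 \<le> a" "b \<le> 1"
  obtains ch :: "nat \<Rightarrow> real \<Rightarrow> real" where "\<And>k. ch k \<in> C1c" "\<And>k x. 0 \<le> ch k x" "\<And>k x. ch k x \<le> 1"
    "\<And>x. (\<lambda>k. ch k x) \<longlonglongrightarrow> indicator {a<..<b} x"
proof -
  \<comment> \<open>For a < b, subtracting 1/(k+1) moves the zero set of the product inwards: {p >=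
    0} is a compact subset of the open interval (a,b).\<close>
  define p where "p k x = (x - a) * (b - x) - 1 / real (Suc k)" for k x
  define r where "r k x = (max 0 (p k x))\<^sup>2" for k x
  \<comment> \<open>The factor k+1 suffices: at a fixed point of (a,b) the values
    \<open>r k x\<close> have a positive limit, so any factor tending to infinity drives the
    quotient to 1.\<close>
  define c where "c k = real (Suc k)" for k
  \<comment> \<open>The guard takes care of b < a, where the product is positive on (b,a) although
    the interval (a,b) is empty.\<close>
  define ch where "ch k x = (if a < x \<and> x < b then c k * r k x / (1 + c k * r k x) else 0)" for k x
  have r0: "r k x \<ge> 0" for k x by (simp add: r_def)
  have c0: "c k > 0" for k by (simp add: c_def)
  have d0: "1 + c k * r k x > 0" for k x
    using r0[of k x] c0[of k] by (smt (verit) mult_nonneg_nonneg)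
  have b01: "0 \<le> c k * r k x / (1 + c k * r k x)" "c k * r k x / (1 + c k * r k x) \<le> 1" for k x
    using r0[of k x] c0[of k] d0[of k x] by (auto simp: divide_le_eq)
  show ?thesis
  proof
    fix k :: nat
    show "ch k \<in> C1c"
    proof (cases "a < b")
      case False
      then have "ch k = (\<lambda>_. 0)" by (auto simp: ch_def)
      then show ?thesis by (auto intro!: C1cI[where \<phi>' = "\<lambda>_. 0" and K = "{}"])
    next
      case True
      define K where "K = {x \<in> {a..b}. p k x \<ge> 0}"
      have ppos: "a < x \<and> x < b" if "p k x \<ge> 0" for x
      proof -
        have "(x - a) * (b - x) > 0" using that unfolding p_def
          by (smt (verit) divide_pos_pos of_nat_0_less_iff zero_less_Suc)
        then show ?thesis using True by (auto simp: zero_less_mult_iff)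
      qed
      have eq: "ch k = (\<lambda>x. c k * r k x / (1 + c k * r k x))"
      proof
        fix x
        have "r k x = 0" if "\<not> (a < x \<and> x < b)" using ppos[of x] that
          by (auto simp: r_def max_def)
        then show "ch k x = c k * r k x / (1 + c k * r k x)" by (auto simp: ch_def)
      qed
      define r' where "r' x = 2 * max 0 (p k x) * (a + b - 2 * x)" for x
      have p': "(p k has_real_derivative (a + b - 2 * x)) (at x)" for x
        unfolding p_def by (auto intro!: derivative_eq_intros)
      have r': "(r k has_real_derivative r' x) (at x)" for x
        using DERIV_chain2[OF DERIV_max0_square p', of x] by (simp add: r_def[abs_def] r'_def)
      have contr: "continuous_on UNIV (r k)" "continuous_on UNIV r'"
        unfolding r_def r'_def p_def by (auto intro!: continuous_intros)
      show ?thesis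
      proof (rule C1cI)
        show "(ch k has_real_derivative c k * r' x / (1 + c k * r k x)\<^sup>2) (at x)" for x
          unfolding eq using d0[of k x]
          by (auto intro!: derivative_eq_intros r' simp: power2_eq_square divide_simps)
            (auto simp: algebra_simps)
        show "continuous_on UNIV (\<lambda>x. c k * r' x / (1 + c k * r k x)\<^sup>2)"
          by (intro continuous_intros contr) (use d0 in \<open>auto simp: less_imp_neq[symmetric]\<close>)
        have "closed {x. p k x \<ge> 0}" unfolding p_def
          by (intro closed_Collect_le continuous_intros)
        then show "compact K" unfolding K_def
          using compact_Int_closed[of "{a..b}" "{x. p k x \<ge> 0}"] by (simp add: Int_def)
        show "K \<subseteq> {-1<..<1}" using ppos assms unfolding K_def by fastforce
        show "ch k x = 0" if "x \<notin> K" for x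
        proof -
          have "\<not> p k x \<ge> 0" using that ppos[of x] by (auto simp: K_def)
          then show ?thesis by (simp add: eq r_def)
        qed
      qed
    qed
    show "0 \<le> ch k x" "ch k x \<le> 1" for x
      using b01[of k x] by (auto simp: ch_def)
  next
    fix x
    show "(\<lambda>k. ch k x) \<longlonglongrightarrow> indicator {a<..<b} x"
    proof (cases "a < x \<and> x < b")
      case False
      then have "(\<lambda>k. ch k x) = (\<lambda>k. indicator {a<..<b} x)" by (auto simp: ch_def)
      then show ?thesis by simp
    next
      case True
      define q where "q = (x - a) * (b - x)"
      have q0: "q > 0" using True by (simp add: q_def)
      have "(\<lambda>k. 1 / real (Suc k)) \<longlonglongrightarrow> 0" by (rule LIMSEQ_Suc[OF lim_1_over_n])
      then have "(\<lambda>k. r k x) \<longlonglongrightarrow> (max 0 (q - 0))\<^sup>2"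
        unfolding r_def p_def q_def by (intro tendsto_intros)
      then have r: "(\<lambda>k. r k x) \<longlonglongrightarrow> q\<^sup>2" using q0 by simp
      have "filterlim (\<lambda>k. c k) at_top sequentially" unfolding c_def
        by (rule filterlim_compose[OF filterlim_real_sequentially filterlim_Suc])
      then have "filterlim (\<lambda>k. c k * r k x) at_top sequentially"
        using filterlim_tendsto_pos_mult_at_top[OF r, of c] q0 by (simp add: mult.commute)
      then have "filterlim (\<lambda>k. 1 + c k * r k x) at_top sequentially"
        by (rule filterlim_tendsto_add_at_top[OF tendsto_const])
      then have "(\<lambda>k. inverse (1 + c k * r k x)) \<longlonglongrightarrow> 0"
        by (rule tendsto_inverse_0_at_top)
      then have "(\<lambda>k. 1 - inverse (1 + c k * r k x)) \<longlonglongrightarrow> 1 - 0"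
        by (intro tendsto_intros)
      moreover have "1 - inverse (1 + c k * r k x) = ch k x" for k
        using True d0[of k x] by (simp add: ch_def field_simps)
      ultimately show ?thesis using True by simp
    qed
  qed
qed

text \<open>The fundamental lemma of the calculus of variations: by the previous lemma \<open>g\<close> integrates to
  zero over intervals, hence over all Borel sets.\<close>

lemma AE_zero_if_orthogonal_C1c:
  assumes g: "integrable Om g" and orth: "\<And>\<phi>. \<phi> \<in> C1c \<Longrightarrow> (\<integral>x. g x * \<phi> x \<partial>Om) = 0"
  shows "AE x in Om. g x = 0"
proof -
  define G where "G x = indicator {-1<..<1} x * g x" for x
  have G: "integrable lebesgue G"
    using g by (simp add: integrable_restrict_space G_def[abs_def])
  \<comment> \<open>\<open>g\<close> is only Lebesgue measurable, whereas the density argument at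
    the end is about \<open>lborel\<close>. A Borel representative of the extension by zero bridges
    the two.\<close>
  obtain g' where g': "g' \<in> borel_measurable lborel" "AE x in lborel. G x = g' x"
    using completion_ex_borel_measurable_real[OF borel_measurable_integrable[OF G]] by auto
  have AE': "AE x in lebesgue. G x = g' x" using g'(2) by (rule AE_completion)
  have g'leb: "integrable lebesgue g'"
    using G AE' g'(1) by (subst integrable_cong_AE[where g = G]) (auto simp: measurable_completion)
  then have intg': "integrable lborel g'"
    using g'(1) by (simp add: integrable_completion)
  have lhs: "(LINT x:A|lborel. g' x) = (\<integral>x. g x * indicator A x \<partial>Om)" if "A \<in> sets borel" for A
  proof -
    have "(LINT x:A|lborel. g' x) = (\<integral>x. indicator A x * g' x \<partial>lebesgue)"
      unfolding set_lebesgue_integral_def using g'(1) that by (subst integral_completion) auto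
    also have "\<dots> = (\<integral>x. indicator A x * G x \<partial>lebesgue)"
      using AE' g'(1) that borel_measurable_integrable[OF G]
      by (intro integral_cong_AE borel_measurable_times) (auto simp: measurable_completion)
    also have "\<dots> = (\<integral>x. g x * indicator A x \<partial>Om)"
      by (simp add: integral_restrict_space G_def mult_ac)
    finally show ?thesis .
  qed
  have int0: "(\<integral>x. g x * indicator {a<..<b} x \<partial>Om) = 0" for a b
  proof -
    \<comment> \<open>The cut-offs need end points in [-1,1]. Truncating the interval does not
      change the integral, since \<open>Om\<close> lives on (-1,1).\<close>
    obtain ch where ch: "\<And>k. ch k \<in> C1c" "\<And>k x. 0 \<le> ch k x" "\<And>k x. ch k x \<le> 1"
      "\<And>x. (\<lambda>k. ch k x) \<longlonglongrightarrow> indicator {max a (-1)<..<min b 1} x"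
      by (rule ex_C1c_tendsto_indicator[of "max a (-1)" "min b 1"]) auto
    have "(\<lambda>k. \<integral>x. g x * ch k x \<partial>Om) \<longlonglongrightarrow> (\<integral>x. g x * indicator {max a (-1)<..<min b 1} x \<partial>Om)"
    proof (rule integral_dominated_convergence[where w = "\<lambda>x. \<bar>g x\<bar>"])
      show "AE x in Om. (\<lambda>k. g x * ch k x) \<longlonglongrightarrow> g x * indicator {max a (-1)<..<min b 1} x"
        by (intro AE_I2 tendsto_intros ch)
      show "AE x in Om. norm (g x * ch k x) \<le> \<bar>g x\<bar>" for k
        using ch(2,3) by (intro AE_I2) (simp add: abs_mult mult_left_le)
      show "(\<lambda>x. g x * indicator {max a (-1)<..<min b 1} x) \<in> borel_measurable Om"
        by (intro borel_measurable_times borel_measurable_integrable[OF g] measurable_Om_borel) auto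
      show "(\<lambda>x. g x * ch k x) \<in> borel_measurable Om" for k
        by (intro borel_measurable_times borel_measurable_integrable[OF g] L2_measurable[OF C1c_L2] ch(1))
    qed (use g in simp)
    then have "(\<integral>x. g x * indicator {max a (-1)<..<min b 1} x \<partial>Om) = 0"
      using orth[OF ch(1)] by (simp add: LIMSEQ_const_iff)
    also have "(\<integral>x. g x * indicator {max a (-1)<..<min b 1} x \<partial>Om) = (\<integral>x. g x * indicator {a<..<b} x \<partial>Om)"
      by (intro Bochner_Integration.integral_cong) (auto simp: indicator_def)
    finally show ?thesis .
  qed
  have setint: "set_integrable lborel A g'" if "A \<in> sets borel" for A
    unfolding set_integrable_def by (intro integrable_mult_indicator intg') (use that in simp)
  have "(LINT x:A|lborel. g' x) = 0" if "A \<in> sets lborel" for A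
  proof -
    have borel_eq: "borel = sigma UNIV (range (\<lambda>(a, b). {a <..< b::real}))"
      using borel_eq_box[where 'a = real] by (simp add: box_real)
    have A: "A \<in> sigma_sets UNIV (range (\<lambda>(a, b). {a <..< b::real}))"
      using that by (simp add: borel_eq)
    have Int: "Int_stable (range (\<lambda>(a, b). {a <..< b::real}))"
    proof (rule Int_stableI, safe)
      fix a b c d :: real
      have "{a<..<b} \<inter> {c<..<d} = (\<lambda>(a, b). {a<..<b}) (max a c, min b d)" by auto
      then show "{a<..<b} \<inter> {c<..<d} \<in> range (\<lambda>(a, b). {a<..<b})" by blast
    qed
    have cl: "range (\<lambda>(a, b). {a <..< b::real}) \<subseteq> Pow UNIV" by simp
    have borelI: "B \<in> sets borel" if "B \<in> sigma_sets UNIV (range (\<lambda>(a, b). {a <..< b::real}))" for B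
      using that by (simp add: borel_eq)
    have UN: "(LINT x:UNIV|lborel. g' x) = 0"
    proof -
      have "(\<integral>x. g x * indicator UNIV x \<partial>Om) = (\<integral>x. g x * indicator {-1<..<1} x \<partial>Om)"
        by (intro Bochner_Integration.integral_cong) auto
      then show ?thesis using lhs[of UNIV] int0 by simp
    qed
    \<comment> \<open>Dynkin's argument: open intervals are stable under intersection and generate
      the Borel sets, and the sets over which \<open>g'\<close> integrates to 0 are closed under
      complements (by \<open>UN\<close>) and disjoint countable unions.\<close>
    show ?thesis using Int cl A
    proof (induction rule: sigma_sets_induct_disjoint)
      case (basic B)
      then show ?case using lhs[of B] int0 by auto
    next
      case empty then show ?case by (simp add: set_lebesgue_integral_def)
    next
      case (compl B)
      note B = borelI[OF compl(1)]
      have "(LINT x:B \<union> (UNIV - B)|lborel. g' x) = (LINT x:B|lborel. g' x) + (LINT x:UNIV - B|lborel. g' x)"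
        by (intro set_integral_Un setint) (use B in auto)
      then show ?case using compl UN by (simp add: Un_UNIV_right)
    next
      case (union B)
      have B: "B i \<in> sets borel" for i using union borelI by auto
      have "(LINT x:(\<Union>i. B i)|lborel. g' x) = (\<Sum>i. (LINT x:B i|lborel. g' x))"
        by (rule lebesgue_integral_countable_add)
          (use B union(1) setint in \<open>auto simp: disjoint_family_on_def\<close>)
      then show ?case using union by simp
    qed
  qed
  then have "AE x in lborel. g' x = 0"
    by (intro sigma_finite_measure.density_zero[OF sigma_finite_lborel] intg')
  then have "AE x in lebesgue. g' x = 0" by (rule AE_completion)
  with AE' have "AE x in lebesgue. x \<in> {-1<..<1} \<longrightarrow> g x = 0"
    by eventually_elim (auto simp: G_def)
  then show ?thesis by (subst AE_restrict_space_iff) auto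
qed

lemma Cauchy_Schwarz_L2:
  assumes "f \<in> L2" "g \<in> L2"
  shows "\<bar>\<integral>x. f x * g x \<partial>Om\<bar> \<le> sqrt (\<integral>x. (f x)\<^sup>2 \<partial>Om) * sqrt (\<integral>x. (g x)\<^sup>2 \<partial>Om)"
proof -
  define A B P where "A = (\<integral>x. (f x)\<^sup>2 \<partial>Om)" and "B = (\<integral>x. (g x)\<^sup>2 \<partial>Om)" and "P = (\<integral>x. f x * g x \<partial>Om)"
  have int: "integrable Om (\<lambda>x. (f x)\<^sup>2)" "integrable Om (\<lambda>x. (g x)\<^sup>2)" "integrable Om (\<lambda>x. f x * g x)"
    using assms L2_mult_integrable by (auto simp: L2_def)
  \<comment> \<open>Two parameters instead of one avoid dividing by B, so the degenerate case can be
    read off from the same inequality.\<close>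
  have quad: "0 \<le> s\<^sup>2 * A - 2 * s * t * P + t\<^sup>2 * B" for s t
  proof -
    have "0 \<le> (\<integral>x. (s * f x - t * g x)\<^sup>2 \<partial>Om)"
      by (intro Bochner_Integration.integral_nonneg) simp
    also have "\<dots> = (\<integral>x. s\<^sup>2 * (f x)\<^sup>2 - 2 * s * t * (f x * g x) + t\<^sup>2 * (g x)\<^sup>2 \<partial>Om)"
      by (simp add: power2_eq_square algebra_simps)
    also have "\<dots> = s\<^sup>2 * A - 2 * s * t * P + t\<^sup>2 * B"
      unfolding A_def B_def P_def using int by simp
    finally show ?thesis .
  qed
  have A0: "A \<ge> 0" and B0: "B \<ge> 0"
    unfolding A_def B_def by (auto intro!: Bochner_Integration.integral_nonneg)
  have "P\<^sup>2 \<le> A * B"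
  proof (cases "B = 0")
    case True
    have "P = 0"
    proof (rule ccontr)
      assume "P \<noteq> 0"
      \<comment> \<open>With B = 0 and s = 1 the form is A - 2 t P; this t makes it -1.\<close>
      then show False using quad[of 1 "(A + 1) / (2 * P)"] True by simp
    qed
    then show ?thesis using True by simp
  next
    case False
    \<comment> \<open>The choice s = B, t = P minimises the form up to scaling.\<close>
    have "0 \<le> B * (A * B - P\<^sup>2)"
      using quad[of B P] by (simp add: power2_eq_square algebra_simps)
    then show ?thesis using False B0 by (simp add: zero_le_mult_iff)
  qed
  then have "\<bar>P\<bar> \<le> sqrt (A * B)" by (metis real_sqrt_abs real_sqrt_le_mono)
  then show ?thesis unfolding A_def B_def P_def by (simp add: real_sqrt_mult)
qed

text \<open>A nonempty open set is not negligible. This is the passage from statements almost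
  everywhere to statements at every point.\<close>

lemma continuous_on_AE_zero:
  assumes "continuous_on {-1<..<1} h" and ae: "AE x in Om. h x = (0 :: real)" and x: "x \<in> {-1<..<1}"
  shows "h x = 0"
proof (rule ccontr)
  assume hx: "h x \<noteq> 0"
  define U where "U = {-1<..<1} \<inter> h -` (- {0})"
  have "open U" unfolding U_def
    by (rule continuous_open_preimage[OF assms(1)]) auto
  then have nn: "\<not> negligible U" using hx x by (intro open_not_negligible) (auto simp: U_def)
  have "AE x in lebesgue. x \<in> {-1<..<1} \<longrightarrow> h x = 0"
    using ae by (subst (asm) AE_restrict_space_iff) auto
  then obtain N where "{x. \<not> (x \<in> {-1<..<1} \<longrightarrow> h x = 0)} \<subseteq> N" "N \<in> null_sets lebesgue"
    by (auto simp: eventually_ae_filter)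
  then have "negligible U"
    by (intro negligible_subset[of N U]) (auto simp: U_def negligible_iff_null_sets)
  with nn show False by simp
qed

section \<open>Weak derivatives\<close>

text \<open>The finite set \<open>S\<close> is there for second derivatives: they are not controlled
  at the jumps of the weight, nor at the points where the explicit profile is glued.\<close>

lemma integral_Om_FTC:
  assumes "continuous_on {-1..1} F" "finite S"
    and "\<And>x. x \<in> {-1<..<1} - S \<Longrightarrow> (F has_real_derivative f x) (at x)"
    and "integrable Om f"
  shows "(\<integral>x. f x \<partial>Om) = F 1 - F (-1)"
proof -
  have "(f has_integral (F 1 - F (-1))) {-1..1}"
    by (rule fundamental_theorem_of_calculus_interior_strong[OF assms(2)])
      (use assms in \<open>auto simp: has_real_derivative_iff_has_vector_derivative\<close>)
  then have "integral {-1<..<1} f = F 1 - F (-1)"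
    by (simp add: has_integral_Icc_iff_Ioo integral_unique)
  then show ?thesis
    using assms(4) by (subst lebesgue_integral_eq_integral) auto
qed

lemma weak_derivative_unique:
  assumes "g \<in> L2" "h \<in> L2" "weak_derivative u g" "weak_derivative u h"
  shows "AE x in Om. g x = h x"
proof -
  have "AE x in Om. g x - h x = 0"
  proof (rule AE_zero_if_orthogonal_C1c)
    fix \<phi> assume "\<phi> \<in> C1c"
    moreover from this have "integrable Om (\<lambda>x. g x * \<phi> x)" "integrable Om (\<lambda>x. h x * \<phi> x)"
      using assms by (auto intro!: L2_mult_integrable C1c_L2)
    ultimately show "(\<integral>x. (g x - h x) * \<phi> x \<partial>Om) = 0"
      using assms(3,4) by (auto simp: weak_derivative_def left_diff_distrib)
  qed (use assms in \<open>auto intro!: L2_integrable L2_diff\<close>)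
  then show ?thesis by eventually_elim simp
qed

lemma H1_wderiv:
  assumes "u \<in> H1"
  shows "wderiv u \<in> L2" "weak_derivative u (wderiv u)"
proof -
  have "\<exists>g. g \<in> L2 \<and> weak_derivative u g" using assms by (auto simp: H1_def)
  then have "wderiv u \<in> L2 \<and> weak_derivative u (wderiv u)"
    unfolding wderiv_def by (rule someI_ex)
  then show "wderiv u \<in> L2" "weak_derivative u (wderiv u)" by auto
qed

text \<open>Since \<open>wderiv\<close> is an arbitrary choice, every computation with it goes
  through this comparison with a weak derivative known by other means.\<close>

lemma wderiv_AE_eq:
  assumes "u \<in> L2" "g \<in> L2" "weak_derivative u g"
  shows "u \<in> H1" "wderiv u \<in> L2" "AE x in Om. wderiv u x = g x"
proof -
  show "u \<in> H1" using assms by (auto simp: H1_def)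
  then show "wderiv u \<in> L2" "AE x in Om. wderiv u x = g x"
    using weak_derivative_unique[OF _ assms(2) _ assms(3)] H1_wderiv by auto
qed

lemma weak_derivative_diff:
  assumes "u \<in> L2" "g \<in> L2" "v \<in> L2" "h \<in> L2" "weak_derivative u g" "weak_derivative v h"
  shows "weak_derivative (\<lambda>x. u x - v x) (\<lambda>x. g x - h x)"
  unfolding weak_derivative_def
proof
  fix \<phi> assume \<phi>: "\<phi> \<in> C1c"
  have "integrable Om (\<lambda>x. u x * deriv \<phi> x)" "integrable Om (\<lambda>x. v x * deriv \<phi> x)"
    "integrable Om (\<lambda>x. g x * \<phi> x)" "integrable Om (\<lambda>x. h x * \<phi> x)"
    using assms \<phi> by (auto intro!: L2_mult_integrable C1c_L2 C1c_deriv_L2)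
  then show "(\<integral>x. (u x - v x) * deriv \<phi> x \<partial>Om) = - (\<integral>x. (g x - h x) * \<phi> x \<partial>Om)"
    using assms(5,6) \<phi> by (auto simp: weak_derivative_def left_diff_distrib)
qed

lemma weak_derivative_piecewise_C1:
  assumes u: "continuous_on {-1..1} u" and u': "u' \<in> L2" and "finite S"
    and deriv: "\<And>x. x \<in> {-1<..<1} - S \<Longrightarrow> (u has_real_derivative u' x) (at x)"
  shows "weak_derivative u u'"
  unfolding weak_derivative_def
proof
  fix \<phi> assume \<phi>: "\<phi> \<in> C1c"
  have int: "integrable Om (\<lambda>x. u x * deriv \<phi> x)" "integrable Om (\<lambda>x. u' x * \<phi> x)"
    by (intro L2_mult_integrable continuous_L2[OF u] u' C1c_L2 C1c_deriv_L2 \<phi>)+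
  have "(\<integral>x. u x * deriv \<phi> x + u' x * \<phi> x \<partial>Om) = u 1 * \<phi> 1 - u (-1) * \<phi> (-1)"
  proof (rule integral_Om_FTC[OF _ \<open>finite S\<close>])
    show "continuous_on {-1..1} (\<lambda>x. u x * \<phi> x)"
      by (intro continuous_intros u continuous_on_subset[OF C1cD(3)[OF \<phi>]]) auto
    show "((\<lambda>x. u x * \<phi> x) has_real_derivative u x * deriv \<phi> x + u' x * \<phi> x) (at x)"
      if "x \<in> {-1<..<1} - S" for x
      using DERIV_mult'[OF deriv[OF that] C1cD(1)[OF \<phi>]] by simp
  qed (use int in simp)
  also have "\<dots> = 0" using C1cD(4)[OF \<phi>] by simp
  finally show "(\<integral>x. u x * deriv \<phi> x \<partial>Om) = - (\<integral>x. u' x * \<phi> x \<partial>Om)"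
    using int by simp
qed

lemma C1_wderiv:
  assumes du: "\<And>x. (u has_real_derivative u' x) (at x)" and u': "continuous_on UNIV u'"
  shows "u \<in> H1" "wderiv u \<in> L2" "AE x in Om. wderiv u x = u' x"
proof -
  have "continuous_on UNIV u"
    using du DERIV_isCont continuous_at_imp_continuous_on by blast
  then have c: "continuous_on {-1..1} u" by (rule continuous_on_subset) simp
  have L: "u' \<in> L2" by (intro continuous_L2 continuous_on_subset[OF u']) simp
  note * = wderiv_AE_eq[OF continuous_L2[OF c] L weak_derivative_piecewise_C1[OF c L finite.emptyI]]
  show "u \<in> H1" "wderiv u \<in> L2" "AE x in Om. wderiv u x = u' x"
    using * du by auto
qed

section \<open>Membership in \<open>H10\<close> and integration by parts\<close>

lemma H1_norm_AE:
  assumes "AE x in Om. wderiv u x = g x" "g \<in> L2" "wderiv u \<in> L2"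
  shows "H1_norm u = sqrt ((\<integral>x. (u x)\<^sup>2 \<partial>Om) + (\<integral>x. (g x)\<^sup>2 \<partial>Om))"
proof -
  have "(\<integral>x. (wderiv u x)\<^sup>2 \<partial>Om) = (\<integral>x. (g x)\<^sup>2 \<partial>Om)"
    by (intro integral_cong_AE borel_measurable_power L2_measurable assms) (use assms(1) in auto)
  then show ?thesis by (simp add: H1_norm_def)
qed

text \<open>The dilations \<open>x \<mapsto> u ((1 + 1/k) x)\<close> are compactly supported in \<open>(-1,1)\<close> and converge
  to \<open>u\<close> in \<open>H\<^sup>1\<close>.\<close>

lemma H10_flat_C1:
  assumes du: "\<And>x. (u has_real_derivative u' x) (at x)" and u': "continuous_on UNIV u'"
    and zero: "\<And>x. \<bar>x\<bar> \<ge> 1 \<Longrightarrow> u x = 0"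
  shows "u \<in> H10"
proof -
  have cu: "continuous_on UNIV u"
    using du DERIV_isCont continuous_at_imp_continuous_on by blast
  define s where "s k = 1 + 1 / real (Suc k)" for k
  have s: "1 < s k" "s k \<le> 2" for k by (auto simp: s_def)
  have slim: "s \<longlonglongrightarrow> 1"
    using tendsto_add[OF tendsto_const[of 1] LIMSEQ_Suc[OF lim_1_over_n]] by (simp add: s_def[abs_def])
  define \<phi> where "\<phi> k x = u (s k * x)" for k x
  have d\<phi>: "(\<phi> k has_real_derivative u' (s k * x) * s k) (at x)" for k x
    unfolding \<phi>_def[abs_def] by (intro DERIV_chain2[OF du]) (auto intro!: derivative_eq_intros)
  have c\<phi>': "continuous_on UNIV (\<lambda>x. u' (s k * x) * s k)" for k
    by (intro continuous_intros continuous_on_compose2[OF u']) auto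
  have \<phi>: "\<phi> k \<in> C1c" for k
  proof (rule C1cI[OF d\<phi> c\<phi>'])
    show "compact {- (1 / s k)..1 / s k}" by simp
    show "{- (1 / s k)..1 / s k} \<subseteq> {-1<..<1}"
    proof
      fix x assume "x \<in> {- (1 / s k)..1 / s k}"
      moreover have "1 / s k < 1" using s[of k] by simp
      ultimately show "x \<in> {-1<..<1}" by auto
    qed
    show "\<phi> k x = 0" if "x \<notin> {- (1 / s k)..1 / s k}" for x
      unfolding \<phi>_def
    proof (rule zero)
      have "\<bar>x\<bar> > 1 / s k" using that by auto
      then show "\<bar>s k * x\<bar> \<ge> 1" using s[of k] by (simp add: abs_mult field_simps)
    qed
  qed
  have diff: "((\<lambda>x. u x - \<phi> k x) has_real_derivative u' x - u' (s k * x) * s k) (at x)" for k x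
    by (intro derivative_intros du d\<phi>)
  have cdiff: "continuous_on UNIV (\<lambda>x. u' x - u' (s k * x) * s k)" for k
    by (intro continuous_intros u' c\<phi>')
  have cdiff0: "continuous_on UNIV (\<lambda>x. u x - \<phi> k x)" for k
    using diff DERIV_isCont continuous_at_imp_continuous_on by blast
  have norm: "H1_norm (\<lambda>x. u x - \<phi> k x) =
      sqrt ((\<integral>x. (u x - \<phi> k x)\<^sup>2 \<partial>Om) + (\<integral>x. (u' x - u' (s k * x) * s k)\<^sup>2 \<partial>Om))" for k
    by (intro H1_norm_AE C1_wderiv[OF diff cdiff] continuous_L2 continuous_on_subset[OF cdiff]) simp
  \<comment> \<open>As 1 < s k \<le> 2, all the arguments s k * x stay in [-2,2], so one constant
    dominates for every k.\<close>
  have bound: "\<exists>B. \<forall>x \<in> {-2..2}. \<bar>h x\<bar> \<le> B" if "continuous_on UNIV h" for h :: "real \<Rightarrow> real"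
  proof -
    have "compact (h ` {-2..2})"
      by (intro compact_continuous_image continuous_on_subset[OF that]) auto
    from compact_imp_bounded[OF this] show ?thesis unfolding bounded_iff by auto
  qed
  obtain B where B: "\<And>x. x \<in> {-2..2} \<Longrightarrow> \<bar>u x\<bar> \<le> B" using bound[OF cu] by blast
  obtain B' where B': "\<And>x. x \<in> {-2..2} \<Longrightarrow> \<bar>u' x\<bar> \<le> B'" using bound[OF u'] by blast
  have sx: "s k * x \<in> {-2..2}" if "x \<in> {-1<..<1}" for k x
  proof -
    have "\<bar>s k * x\<bar> \<le> 2 * 1" unfolding abs_mult
      using that s[of k] by (intro mult_mono) auto
    then show ?thesis by (simp add: abs_le_iff)
  qed
  have slimx: "(\<lambda>k. s k * x) \<longlonglongrightarrow> x" for x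
    using tendsto_mult[OF slim tendsto_const[of x]] by simp
  have iso: "isCont u x" "isCont u' x" for x
    using cu u' by (auto simp: continuous_on_eq_continuous_at)
  have "(\<lambda>k. \<integral>x. (u x - \<phi> k x)\<^sup>2 \<partial>Om) \<longlonglongrightarrow> (\<integral>x. (u x - u x)\<^sup>2 \<partial>Om)"
  proof (rule integral_dominated_convergence[where w = "\<lambda>_. (2 * B)\<^sup>2"])
    show "AE x in Om. (\<lambda>k. (u x - \<phi> k x)\<^sup>2) \<longlonglongrightarrow> (u x - u x)\<^sup>2"
      unfolding \<phi>_def by (intro AE_I2 tendsto_intros isCont_tendsto_compose[OF iso(1)] slimx)
    show "AE x in Om. norm ((u x - \<phi> k x)\<^sup>2) \<le> (2 * B)\<^sup>2" for k
    proof (rule AE_I2)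
      fix x assume "x \<in> space Om"
      then have x: "x \<in> {-1<..<1}" by (simp only: space_Om)
      have "\<bar>u x - \<phi> k x\<bar> \<le> \<bar>2 * B\<bar>"
        using B[of x] B[OF sx[OF x, of k]] x unfolding \<phi>_def by auto
      then show "norm ((u x - \<phi> k x)\<^sup>2) \<le> (2 * B)\<^sup>2"
        by (simp add: abs_le_square_iff del: abs_mult)
    qed
    show "integrable Om (\<lambda>_. (2 * B)\<^sup>2)" by (rule L2_integrable[OF L2_const])
    show "(\<lambda>x. (u x - \<phi> k x)\<^sup>2) \<in> borel_measurable Om" for k
      by (intro continuous_measurable_Om continuous_intros cdiff0)
  qed simp
  moreover have "(\<lambda>k. \<integral>x. (u' x - u' (s k * x) * s k)\<^sup>2 \<partial>Om) \<longlonglongrightarrow> (\<integral>x. (u' x - u' x * 1)\<^sup>2 \<partial>Om)"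
  proof (rule integral_dominated_convergence[where w = "\<lambda>_. (3 * B')\<^sup>2"])
    show "AE x in Om. (\<lambda>k. (u' x - u' (s k * x) * s k)\<^sup>2) \<longlonglongrightarrow> (u' x - u' x * 1)\<^sup>2"
      by (intro AE_I2 tendsto_intros isCont_tendsto_compose[OF iso(2)] slimx slim)
    show "AE x in Om. norm ((u' x - u' (s k * x) * s k)\<^sup>2) \<le> (3 * B')\<^sup>2" for k
    proof (rule AE_I2)
      fix x assume "x \<in> space Om"
      then have x: "x \<in> {-1<..<1}" by (simp only: space_Om)
      \<comment> \<open>The chain rule contributes a factor of at most 2, whence 3 B' in place of 2
        B'.\<close>
      have "\<bar>u' (s k * x) * s k\<bar> \<le> B' * 2" unfolding abs_mult
        using B'[OF sx[OF x, of k]] s[of k] by (intro mult_mono) auto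
      then have "\<bar>u' x - u' (s k * x) * s k\<bar> \<le> \<bar>3 * B'\<bar>"
        using B'[of x] x by auto
      then show "norm ((u' x - u' (s k * x) * s k)\<^sup>2) \<le> (3 * B')\<^sup>2"
        by (simp add: abs_le_square_iff del: abs_mult)
    qed
    show "integrable Om (\<lambda>_. (3 * B')\<^sup>2)" by (rule L2_integrable[OF L2_const])
    show "(\<lambda>x. (u' x - u' (s k * x) * s k)\<^sup>2) \<in> borel_measurable Om" for k
      by (intro continuous_measurable_Om continuous_intros cdiff)
  qed simp
  ultimately have "(\<lambda>k. H1_norm (\<lambda>x. u x - \<phi> k x)) \<longlonglongrightarrow> sqrt (0 + 0)"
    unfolding norm by (intro tendsto_intros) auto
  moreover have "u \<in> H1" by (rule C1_wderiv[OF du u'])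
  ultimately show ?thesis using \<phi> unfolding H10_def by auto
qed

lemma C1c_wderiv:
  assumes "\<phi> \<in> C1c"
  shows "wderiv \<phi> \<in> L2" "AE x in Om. wderiv \<phi> x = deriv \<phi> x"
  using C1_wderiv[OF C1cD(1)[OF assms] C1cD(2)[OF assms]] by auto

lemma C1c_H10: "\<phi> \<in> C1c \<Longrightarrow> \<phi> \<in> H10"
  using H10_flat_C1[OF C1cD(1) C1cD(2)] C1cD(4) by blast

text \<open>The identity holds for test functions, and both sides are continuous in the \<open>H\<^sup>1\<close> norm.\<close>

lemma H10_integration_by_parts:
  assumes U: "continuous_on {-1..1} U" and f: "f \<in> L2" and "finite S"
    and dU: "\<And>x. x \<in> {-1<..<1} - S \<Longrightarrow> (U has_real_derivative - f x) (at x)"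
    and v: "v \<in> H10"
  shows "(\<integral>x. U x * wderiv v x \<partial>Om) = (\<integral>x. f x * v x \<partial>Om)"
proof -
  note UL = continuous_L2[OF U]
  have vH: "v \<in> H1" using v by (simp add: H10_def)
  then have vL: "v \<in> L2" by (simp add: H1_def)
  obtain \<phi> where \<phi>: "\<And>k. \<phi> k \<in> C1c" and lim: "(\<lambda>k. H1_norm (\<lambda>x. v x - \<phi> k x)) \<longlonglongrightarrow> 0"
    using v by (auto simp: H10_def)
  have "(\<lambda>x. - f x) \<in> L2" using L2_cmult[OF f, of "-1"] by simp
  then have weak: "weak_derivative U (\<lambda>x. - f x)"
    by (rule weak_derivative_piecewise_C1[OF U _ \<open>finite S\<close> dU])
  define I where "I = (\<integral>x. U x * wderiv v x \<partial>Om) - (\<integral>x. f x * v x \<partial>Om)"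
  define C where "C = sqrt (\<integral>x. (U x)\<^sup>2 \<partial>Om) + sqrt (\<integral>x. (f x)\<^sup>2 \<partial>Om)"
  have "\<bar>I\<bar> \<le> C * H1_norm (\<lambda>x. v x - \<phi> k x)" for k
  proof -
    \<comment> \<open>The identity is exact for \<open>\<phi> k\<close>, so the defect
      \<open>I\<close> of v equals the defect of the error \<open>w\<close>, which Cauchy-Schwarz
      bounds by its norm.\<close>
    define w where "w x = v x - \<phi> k x" for x
    have d\<phi>: "weak_derivative (\<phi> k) (deriv (\<phi> k))"
      by (rule weak_derivative_piecewise_C1[where S = "{}"])
        (use \<phi>[of k] in \<open>auto intro!: C1c_deriv_L2 C1cD continuous_on_subset[OF C1cD(3)]\<close>)
    have wL: "w \<in> L2" unfolding w_def[abs_def] by (intro L2_diff vL C1c_L2 \<phi>)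
    have dw: "(\<lambda>x. wderiv v x - deriv (\<phi> k) x) \<in> L2"
      by (intro L2_diff H1_wderiv vH C1c_deriv_L2 \<phi>)
    have "weak_derivative w (\<lambda>x. wderiv v x - deriv (\<phi> k) x)"
      unfolding w_def[abs_def]
      by (intro weak_derivative_diff vL H1_wderiv vH C1c_L2 C1c_deriv_L2 \<phi> d\<phi>)
    note w = wderiv_AE_eq[OF wL dw this]
    have "(\<integral>x. U x * wderiv w x \<partial>Om) = (\<integral>x. U x * (wderiv v x - deriv (\<phi> k) x) \<partial>Om)"
      by (intro integral_cong_AE borel_measurable_times L2_measurable UL w dw) (use w(3) in auto)
    also have "\<dots> = (\<integral>x. U x * wderiv v x \<partial>Om) - (\<integral>x. U x * deriv (\<phi> k) x \<partial>Om)"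
      unfolding right_diff_distrib
      by (intro Bochner_Integration.integral_diff L2_mult_integrable UL H1_wderiv vH C1c_deriv_L2 \<phi>)
    also have "(\<integral>x. U x * deriv (\<phi> k) x \<partial>Om) = (\<integral>x. f x * \<phi> k x \<partial>Om)"
      using weak \<phi>[of k] by (simp add: weak_derivative_def)
    finally have 1: "(\<integral>x. U x * wderiv w x \<partial>Om) = (\<integral>x. U x * wderiv v x \<partial>Om) - (\<integral>x. f x * \<phi> k x \<partial>Om)" .
    have 2: "(\<integral>x. f x * w x \<partial>Om) = (\<integral>x. f x * v x \<partial>Om) - (\<integral>x. f x * \<phi> k x \<partial>Om)"
      unfolding right_diff_distrib w_def
      by (intro Bochner_Integration.integral_diff L2_mult_integrable f vL C1c_L2 \<phi>)
    have le: "sqrt (\<integral>x. (w x)\<^sup>2 \<partial>Om) \<le> H1_norm w" "sqrt (\<integral>x. (wderiv w x)\<^sup>2 \<partial>Om) \<le> H1_norm w"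
      unfolding H1_norm_def by (auto intro!: Bochner_Integration.integral_nonneg)
    have "\<bar>I\<bar> = \<bar>(\<integral>x. U x * wderiv w x \<partial>Om) - (\<integral>x. f x * w x \<partial>Om)\<bar>"
      using 1 2 by (simp add: I_def)
    also have "\<dots> \<le> \<bar>\<integral>x. U x * wderiv w x \<partial>Om\<bar> + \<bar>\<integral>x. f x * w x \<partial>Om\<bar>" by simp
    also have "\<dots> \<le> sqrt (\<integral>x. (U x)\<^sup>2 \<partial>Om) * H1_norm w + sqrt (\<integral>x. (f x)\<^sup>2 \<partial>Om) * H1_norm w"
      by (intro add_mono order_trans[OF Cauchy_Schwarz_L2[OF UL w(2)]]
          order_trans[OF Cauchy_Schwarz_L2[OF f wL]] mult_left_mono le)
        (auto intro!: Bochner_Integration.integral_nonneg)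
    finally show ?thesis by (simp add: C_def w_def[abs_def] distrib_right)
  qed
  then have "\<bar>I\<bar> \<le> C * 0"
    by (intro LIMSEQ_le_const[OF tendsto_mult[OF tendsto_const lim]]) auto
  then show ?thesis by (simp add: I_def)
qed

section \<open>Regularity of weak solutions\<close>

text \<open>The lemma of du Bois-Reymond: every \<open>\<psi> \<in> C1c\<close> is, up to a multiple of a fixed bump, the
  derivative of a test function.\<close>

lemma AE_const_if_orthogonal_deriv_C1c:
  assumes g: "g \<in> L2" and orth: "\<And>\<phi>. \<phi> \<in> C1c \<Longrightarrow> (\<integral>x. g x * deriv \<phi> x \<partial>Om) = 0"
  obtains c where "AE x in Om. g x = c"
proof -
  obtain \<psi>1 where \<psi>1: "\<psi>1 \<in> C1c" "(\<integral>x. \<psi>1 x \<partial>Om) \<noteq> 0"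
  proof -
    \<comment> \<open>A test function with nonzero integral exists by the fundamental lemma itself:
      otherwise the constant 1 would vanish almost everywhere.\<close>
    have "\<not> (\<forall>\<psi>\<in>C1c. (\<integral>x. \<psi> x \<partial>Om) = 0)"
    proof
      assume "\<forall>\<psi>\<in>C1c. (\<integral>x. \<psi> x \<partial>Om) = 0"
      then have "AE x in Om. (1 :: real) = 0"
        by (intro AE_zero_if_orthogonal_C1c L2_integrable[OF L2_const]) auto
      then show False using continuous_on_AE_zero[of "\<lambda>_. 1" 0] by auto
    qed
    then show thesis using that by auto
  qed
  define \<psi>0 where "\<psi>0 x = \<psi>1 x / (\<integral>x. \<psi>1 x \<partial>Om)" for x
  have \<psi>0L: "\<psi>0 \<in> L2"
    using L2_cmult[OF C1c_L2[OF \<psi>1(1)], of "1 / (\<integral>x. \<psi>1 x \<partial>Om)"] by (simp add: \<psi>0_def[abs_def])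
  have \<psi>0int: "(\<integral>x. \<psi>0 x \<partial>Om) = 1" using \<psi>1(2) by (simp add: \<psi>0_def)
  obtain K0 where K0: "compact K0" "K0 \<subseteq> {-1<..<1}" "\<And>x. x \<notin> K0 \<Longrightarrow> \<psi>0 x = 0"
    using \<psi>1(1) by (auto simp: C1c_def \<psi>0_def)
  have c\<psi>0: "continuous_on UNIV \<psi>0"
    using \<psi>1(2) C1cD(3)[OF \<psi>1(1)] unfolding \<psi>0_def[abs_def] by (intro continuous_intros) auto
  define c where "c = (\<integral>x. g x * \<psi>0 x \<partial>Om)"
  have "AE x in Om. g x - c = 0"
  proof (rule AE_zero_if_orthogonal_C1c)
    fix \<psi> assume \<psi>: "\<psi> \<in> C1c"
    define m where "m = (\<integral>x. \<psi> x \<partial>Om)"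
    \<comment> \<open>Removing the multiple m of the normalised bump makes the integral 0, and this
      is exactly what gives the primitive compact support.\<close>
    define \<eta> where "\<eta> x = \<psi> x - m * \<psi>0 x" for x
    obtain K1 where K1: "compact K1" "K1 \<subseteq> {-1<..<1}" "\<And>x. x \<notin> K1 \<Longrightarrow> \<psi> x = 0"
      using \<psi> by (auto simp: C1c_def)
    \<comment> \<open>Inserting 0 keeps \<open>K\<close> nonempty, so that it has a least and a
      greatest element.\<close>
    define K where "K = insert 0 (K0 \<union> K1)"
    have K: "compact K" "K \<noteq> {}" "K \<subseteq> {-1<..<1}"
      using K0 K1 by (auto simp: K_def intro!: compact_insert compact_Un)
    have \<eta>0: "\<eta> x = 0" if "x \<notin> K" for x using that K0(3) K1(3) by (auto simp: \<eta>_def K_def)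
    have c\<eta>: "continuous_on UNIV \<eta>"
      unfolding \<eta>_def[abs_def] by (intro continuous_intros C1cD \<psi> c\<psi>0)
    have int\<psi>: "integrable Om \<psi>" "integrable Om \<psi>0"
      by (auto intro!: L2_integrable C1c_L2 \<psi> \<psi>0L)
    have \<eta>int: "(\<integral>x. \<eta> x \<partial>Om) = 0"
      using int\<psi> \<psi>0int by (simp add: \<eta>_def m_def)
    obtain l where l: "l \<in> K" "\<And>x. x \<in> K \<Longrightarrow> l \<le> x"
      using compact_attains_inf[OF K(1,2)] by auto
    obtain r where r: "r \<in> K" "\<And>x. x \<in> K \<Longrightarrow> x \<le> r"
      using compact_attains_sup[OF K(1,2)] by auto
    have lr: "-1 < l" "r < 1" using l(1) r(1) K(3) by auto
    define \<phi> where "\<phi> x = integral {-1..x} \<eta>" for x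
    have left: "\<phi> x = 0" if "x < l" for x
    proof -
      have "integral {-1..x} \<eta> = integral {-1..x} (\<lambda>_. 0)"
        by (rule Henstock_Kurzweil_Integration.integral_cong) (use that l(2) \<eta>0 in fastforce)
      then show ?thesis by (simp add: \<phi>_def)
    qed
    have right: "\<phi> x = 0" if "x > r" for x
    proof -
      have "integrable Om \<eta>"
        unfolding \<eta>_def[abs_def] using int\<psi> by simp
      then have "(\<eta> has_integral 0) {-1<..<1}"
        using has_integral_integral_lebesgue_on[of "{-1<..<1}" \<eta>] \<eta>int by simp
      moreover have "(\<lambda>y. if y \<in> {-1<..<1} then \<eta> y else 0) = (\<lambda>y. if y \<in> {-1..x} then \<eta> y else 0)"
        using \<eta>0 K(3) r(2) that by (intro ext) (smt (verit) atLeastAtMost_iff greaterThanLessThan_iff subsetD)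
      ultimately have "(\<eta> has_integral 0) {-1..x}"
        by (metis (no_types) has_integral_restrict_UNIV)
      then show ?thesis by (simp add: \<phi>_def integral_unique)
    qed
    have d\<phi>: "(\<phi> has_real_derivative \<eta> x) (at x)" for x
    proof (cases "x < l")
      case True
      then have "\<eta> x = 0" using l(2) \<eta>0 by force
      moreover have "((\<lambda>_. 0) has_real_derivative 0) (at x)" by simp
      ultimately show ?thesis
        using True left by (auto intro: has_field_derivative_transform_within_open[of "\<lambda>_. 0" _ _ "{..<l}"])
    next
      case False
      \<comment> \<open>Here x \<ge> l > -1, so x is interior to [-1, x + 1] and the derivative
        within the interval is a full one.\<close>
      have "(\<phi> has_vector_derivative \<eta> x) (at x within {-1..x + 1})"
        unfolding \<phi>_def[abs_def]
        by (rule integral_has_vector_derivative)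
          (use False lr in \<open>auto intro!: continuous_on_subset[OF c\<eta>]\<close>)
      moreover have "at x within {-1..x + 1} = at x"
        by (rule at_within_interior) (use False lr in \<open>simp add: interior_atLeastAtMost_real\<close>)
      ultimately show ?thesis by (simp add: has_real_derivative_iff_has_vector_derivative)
    qed
    have "\<phi> \<in> C1c"
      by (rule C1cI[OF d\<phi> c\<eta>, of "{l..r}"]) (use lr left right in \<open>auto simp: not_le\<close>)
    moreover have "deriv \<phi> = \<eta>" using d\<phi> DERIV_imp_deriv by blast
    ultimately have "0 = (\<integral>x. g x * (\<psi> x - m * \<psi>0 x) \<partial>Om)"
      using orth[of \<phi>] by (simp add: \<eta>_def)
    also have "\<dots> = (\<integral>x. g x * \<psi> x - m * (g x * \<psi>0 x) \<partial>Om)"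
      by (simp add: algebra_simps)
    also have "\<dots> = (\<integral>x. g x * \<psi> x \<partial>Om) - m * c"
      using L2_mult_integrable[OF g C1c_L2[OF \<psi>]] L2_mult_integrable[OF g \<psi>0L] by (simp add: c_def)
    also have "\<dots> = (\<integral>x. (g x - c) * \<psi> x \<partial>Om)"
      using L2_mult_integrable[OF g C1c_L2[OF \<psi>]] int\<psi> by (simp add: m_def left_diff_distrib)
    finally show "(\<integral>x. (g x - c) * \<psi> x \<partial>Om) = 0" by simp
  qed (intro L2_integrable L2_diff g L2_const)
  then show thesis by (intro that[of c]) (auto elim: eventually_mono)
qed

text \<open>Du Bois-Reymond is used twice. As F is a primitive of f, the weak equation says that
  \<open>wderiv v + F\<close> has weak derivative 0, so it is a constant c almost everywhere; then v
  minus a primitive of c - F has weak derivative 0 as well. Continuity of v turns the second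
  equality into one at every point.\<close>

lemma weak_solution_C1:
  assumes v: "v \<in> H1" "continuous_on {-1..1} v" and f: "f \<in> L2"
    and F: "continuous_on {-1..1} F" and "finite S"
    and dF: "\<And>x. x \<in> {-1<..<1} - S \<Longrightarrow> (F has_real_derivative f x) (at x)"
    and weak: "\<And>\<phi>. \<phi> \<in> C1c \<Longrightarrow> (\<integral>x. wderiv v x * deriv \<phi> x \<partial>Om) = (\<integral>x. f x * \<phi> x \<partial>Om)"
  obtains c where "\<And>x. x \<in> {-1<..<1} \<Longrightarrow> (v has_real_derivative c - F x) (at x)"
proof -
  note FL = continuous_L2[OF F] and vL = continuous_L2[OF v(2)]
  have weakF: "weak_derivative F f"
    by (rule weak_derivative_piecewise_C1[OF F f \<open>finite S\<close> dF])
  obtain c where c: "AE x in Om. wderiv v x + F x = c"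
  proof (rule AE_const_if_orthogonal_deriv_C1c)
    show "(\<lambda>x. wderiv v x + F x) \<in> L2" by (intro L2_add H1_wderiv v FL)
    fix \<phi> assume \<phi>: "\<phi> \<in> C1c"
    have "integrable Om (\<lambda>x. wderiv v x * deriv \<phi> x)" "integrable Om (\<lambda>x. F x * deriv \<phi> x)"
      using \<phi> v FL by (auto intro!: L2_mult_integrable H1_wderiv C1c_deriv_L2)
    then show "(\<integral>x. (wderiv v x + F x) * deriv \<phi> x \<partial>Om) = 0"
      using weak[OF \<phi>] weakF \<phi> by (simp add: distrib_right weak_derivative_def)
  qed
  define G where "G x = integral {-1..x} (\<lambda>x. c - F x)" for x
  have cF: "continuous_on {-1..1} (\<lambda>x. c - F x)" by (intro continuous_intros F)
  have cG: "continuous_on {-1..1} G" unfolding G_def[abs_def]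
    by (intro indefinite_integral_continuous_1 integrable_continuous_interval cF)
  have dG: "(G has_real_derivative c - F x) (at x)" if "x \<in> {-1<..<1}" for x
  proof -
    have "(G has_vector_derivative c - F x) (at x within {-1..1})"
      unfolding G_def[abs_def] by (rule integral_has_vector_derivative[OF cF]) (use that in auto)
    moreover have "at x within {-1..1} = at x"
      by (rule at_within_interior) (use that in \<open>simp add: interior_atLeastAtMost_real\<close>)
    ultimately show ?thesis by (simp add: has_real_derivative_iff_has_vector_derivative)
  qed
  note cFL = continuous_L2[OF cF]
  have weakG: "weak_derivative G (\<lambda>x. c - F x)"
    by (rule weak_derivative_piecewise_C1[OF cG cFL finite.emptyI]) (use dG in auto)
  obtain d where d: "AE x in Om. v x - G x = d"
  proof (rule AE_const_if_orthogonal_deriv_C1c)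
    show "(\<lambda>x. v x - G x) \<in> L2" by (intro L2_diff vL continuous_L2 cG)
    fix \<phi> assume \<phi>: "\<phi> \<in> C1c"
    have int: "integrable Om (\<lambda>x. v x * deriv \<phi> x)" "integrable Om (\<lambda>x. G x * deriv \<phi> x)"
      using \<phi> vL continuous_L2[OF cG] by (auto intro!: L2_mult_integrable C1c_deriv_L2)
    have "(\<integral>x. wderiv v x * \<phi> x \<partial>Om) = (\<integral>x. (c - F x) * \<phi> x \<partial>Om)"
      by (intro integral_cong_AE borel_measurable_times L2_measurable H1_wderiv v C1c_L2 \<phi> cFL)
        (use c in \<open>auto elim!: eventually_mono\<close>)
    then show "(\<integral>x. (v x - G x) * deriv \<phi> x \<partial>Om) = 0"
      using int weakG H1_wderiv(2)[OF v(1)] \<phi> by (simp add: left_diff_distrib weak_derivative_def)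
  qed
  have eq: "v x = G x + d" if "x \<in> {-1<..<1}" for x
  proof -
    have "continuous_on {-1<..<1} (\<lambda>x. v x - G x - d)"
      by (intro continuous_intros continuous_on_subset[OF v(2)] continuous_on_subset[OF cG]) auto
    from continuous_on_AE_zero[OF this _ that] show ?thesis
      using d by (auto elim!: eventually_mono)
  qed
  show thesis
  proof (rule that)
    fix x :: real assume x: "x \<in> {-1<..<1}"
    have "((\<lambda>x. G x + d) has_real_derivative c - F x) (at x)"
      using dG[OF x] by (auto intro!: derivative_eq_intros)
    then show "(v has_real_derivative c - F x) (at x)"
      by (rule has_field_derivative_transform_within_open[of _ _ _ "{-1<..<1}"]) (use x eq in auto)
  qed
qed

section \<open>One-variable calculus\<close>

lemma DERIV_glue:
  fixes f g :: "real \<Rightarrow> real"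
  assumes "(f has_real_derivative D) (at a)" "(g has_real_derivative D) (at a)" "f a = g a"
  shows "((\<lambda>x. if x \<le> a then f x else g x) has_real_derivative D) (at a)"
proof -
  let ?h = "\<lambda>x. if x \<le> a then f x else g x"
  have f: "((\<lambda>y. (f y - f a) / (y - a)) \<longlongrightarrow> D) (at a)"
    and g: "((\<lambda>y. (g y - g a) / (y - a)) \<longlongrightarrow> D) (at a)"
    using assms by (simp_all add: has_field_derivative_iff)
  have "((\<lambda>y. (?h y - ?h a) / (y - a)) \<longlongrightarrow> D) (at_left a)"
    using filterlim_at_split[THEN iffD1, OF f] by (auto elim: tendsto_cong[THEN iffD1, rotated]
      simp: eventually_at_filter)
  moreover have "((\<lambda>y. (?h y - ?h a) / (y - a)) \<longlongrightarrow> D) (at_right a)"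
    using filterlim_at_split[THEN iffD1, OF g] assms(3)
    by (auto elim: tendsto_cong[THEN iffD1, rotated] simp: eventually_at_filter)
  ultimately show ?thesis by (simp add: has_field_derivative_iff filterlim_at_split)
qed

text \<open>The difference quotient is O(|y - x|^(q-1)). It serves at zeros of the base of a power,
  where the usual rule for \<open>powr\<close> does not apply.\<close>

lemma DERIV_zero_if_powr_bound:
  fixes h :: "real \<Rightarrow> real"
  assumes "q > 1" "h x = 0" and bound: "\<forall>\<^sub>F y in at x. \<bar>h y\<bar> \<le> C * \<bar>y - x\<bar> powr q"
  shows "(h has_real_derivative 0) (at x)"
  unfolding has_field_derivative_iff
proof (rule Lim_null_comparison)
  show "\<forall>\<^sub>F y in at x. norm ((h y - h x) / (y - x)) \<le> C * \<bar>y - x\<bar> powr (q - 1)"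
    using bound eventually_at_ball'[of 1 x UNIV, OF zero_less_one]
  proof eventually_elim
    case (elim y)
    then have "\<bar>y - x\<bar> > 0" by auto
    then have "\<bar>h y\<bar> / \<bar>y - x\<bar> \<le> C * \<bar>y - x\<bar> powr q / \<bar>y - x\<bar>"
      using elim by (intro divide_right_mono) auto
    also have "\<dots> = C * \<bar>y - x\<bar> powr (q - 1)"
      using \<open>\<bar>y - x\<bar> > 0\<close> by (simp add: powr_diff)
    finally show ?case using assms(2) by (simp add: abs_divide)
  qed
  have "((\<lambda>y. \<bar>y - x\<bar>) \<longlongrightarrow> \<bar>x - x\<bar>) (at x)" by (intro tendsto_intros)
  then have "((\<lambda>y. \<bar>y - x\<bar> powr (q - 1)) \<longlongrightarrow> 0) (at x)"
    by (intro tendsto_zero_powrI[OF _ tendsto_const]) (use assms in auto)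
  then show "((\<lambda>y. C * \<bar>y - x\<bar> powr (q - 1)) \<longlongrightarrow> 0) (at x)"
    by (rule tendsto_mult_right_zero)
qed

text \<open>At a zero of \<open>f\<close> the derivative of \<open>f\<close> vanishes too, since \<open>f \<ge> 0\<close>.\<close>

lemma DERIV_powr_nonneg:
  fixes f :: "real \<Rightarrow> real"
  assumes "q > 1" and df: "(f has_real_derivative D) (at x)"
    and "0 < d" and nonneg: "\<And>y. \<bar>x - y\<bar> < d \<Longrightarrow> 0 \<le> f y"
  shows "((\<lambda>x. f x powr q) has_real_derivative q * f x powr (q - 1) * D) (at x)"
proof (cases "f x = 0")
  case False
  then have "f x > 0" using nonneg[of x] \<open>0 < d\<close> by force
  from DERIV_chain2[OF has_real_derivative_powr[OF this] df] show ?thesis by simp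
next
  case True
  have D: "D = 0" by (rule DERIV_local_min[OF df \<open>0 < d\<close>]) (use True nonneg in auto)
  have lim: "((\<lambda>y. f y / (y - x)) \<longlongrightarrow> 0) (at x)"
    using df True D by (simp add: has_field_derivative_iff)
  have "((\<lambda>x. f x powr q) has_real_derivative 0) (at x)"
  proof (rule DERIV_zero_if_powr_bound[where q = q and C = 1])
    have "\<forall>\<^sub>F y in at x. \<bar>f y / (y - x)\<bar> < 1"
      using order_tendstoD(2)[OF tendsto_rabs_zero[OF lim], of 1] by simp
    moreover have "\<forall>\<^sub>F y in at x. y \<noteq> x \<and> 0 \<le> f y"
      using eventually_at_ball'[OF \<open>0 < d\<close>, of x UNIV] nonneg
      by (auto elim!: eventually_mono simp: dist_real_def)
    ultimately show "\<forall>\<^sub>F y in at x. \<bar>f y powr q\<bar> \<le> 1 * \<bar>y - x\<bar> powr q"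
    proof eventually_elim
      case (elim y)
      then have "f y \<le> \<bar>y - x\<bar>" by (simp add: abs_divide divide_less_eq)
      then show ?case using elim \<open>q > 1\<close> by (simp add: powr_mono2)
    qed
  qed (use True \<open>q > 1\<close> in auto)
  then show ?thesis using D by simp
qed

text \<open>Dividing by u reduces the claim to r = v/u, and r^\<alpha> lies between 1 and r. Only u
  has to be positive, so the unknown solution v may vanish; the factor blows up as u tends to 0,
  which is why the comparison stops short of b.\<close>

lemma abs_powr_diff_le:
  fixes u v :: real
  assumes "0 < \<alpha>" "\<alpha> < 1" "0 < u" "0 \<le> v"
  shows "\<bar>v powr \<alpha> - u powr \<alpha>\<bar> \<le> u powr (\<alpha> - 1) * \<bar>v - u\<bar>"
proof -
  define r where "r = v / u"
  have v: "v = r * u" and r: "r \<ge> 0" using assms by (auto simp: r_def)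
  have "\<bar>r powr \<alpha> - 1\<bar> \<le> \<bar>r - 1\<bar>"
  proof (cases "r \<ge> 1")
    case True
    then have "r powr \<alpha> \<le> r" "1 \<le> r powr \<alpha>"
      using powr_mono[of \<alpha> 1 r] assms by (simp_all add: ge_one_powr_ge_zero)
    then show ?thesis using True by simp
  next
    case False
    then have "r powr \<alpha> \<le> 1" using assms r by (simp add: powr_le1)
    moreover have "r \<le> r powr \<alpha>"
    proof (cases "r = 0")
      case nz: False
      then have "r powr 1 \<le> r powr \<alpha>" using False r assms by (intro powr_mono') auto
      then show ?thesis using nz r by simp
    qed simp
    ultimately show ?thesis using False by simp
  qed
  then have "u powr \<alpha> * \<bar>r powr \<alpha> - 1\<bar> \<le> u powr \<alpha> * \<bar>r - 1\<bar>" by (rule mult_left_mono) simp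
  moreover have "v powr \<alpha> - u powr \<alpha> = u powr \<alpha> * (r powr \<alpha> - 1)"
    using assms r by (simp add: v powr_mult algebra_simps)
  moreover have "u powr \<alpha> * \<bar>r - 1\<bar> = u powr (\<alpha> - 1) * \<bar>v - u\<bar>"
  proof -
    have "v - u = u * (r - 1)" by (simp add: v algebra_simps)
    moreover have "u powr \<alpha> = u powr (\<alpha> - 1) * u" using assms by (simp add: powr_diff)
    ultimately show ?thesis using assms by (simp add: abs_mult)
  qed
  ultimately show ?thesis by (simp add: abs_mult)
qed

text \<open>Gronwall's argument: \<open>(d\<^sup>2 + D\<^sup>2) exp (- (1 + L) x)\<close> is nonincreasing.\<close>

lemma second_order_zero:
  fixes d D r :: "real \<Rightarrow> real"
  assumes cont: "continuous_on {p..q} d" "continuous_on {p..q} D"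
    and d: "\<And>x. p < x \<Longrightarrow> x < q \<Longrightarrow> (d has_real_derivative D x) (at x)"
    and D: "\<And>x. p < x \<Longrightarrow> x < q \<Longrightarrow> (D has_real_derivative r x) (at x)"
    and r: "\<And>x. p < x \<Longrightarrow> x < q \<Longrightarrow> \<bar>r x\<bar> \<le> L * \<bar>d x\<bar>"
    and init: "d p = 0" "D p = 0" and x: "p \<le> x" "x \<le> q" and "0 \<le> L"
  shows "d x = 0 \<and> D x = 0"
proof -
  \<comment> \<open>The summand 1 absorbs 2 d D and the summand L absorbs 2 D r, both measured
    against d^2 + D^2.\<close>
  define K where "K = 1 + L"
  define e where "e x = ((d x)\<^sup>2 + (D x)\<^sup>2) * exp (- K * x)" for x
  have "e p \<ge> e x"
  proof (rule DERIV_nonpos_imp_decreasing_open[OF x(1)])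
    fix y assume y: "p < y" "y < x"
    then have yq: "y < q" using x by simp
    let ?e' = "(2 * d y * D y + 2 * D y * r y - K * ((d y)\<^sup>2 + (D y)\<^sup>2)) * exp (- K * y)"
    have "(e has_real_derivative ?e') (at y)"
      unfolding e_def[abs_def]
      by (rule derivative_eq_intros refl d D y yq)+ (simp add: algebra_simps)
    moreover have "2 * d y * D y \<le> (d y)\<^sup>2 + (D y)\<^sup>2" by (rule sum_squares_bound)
    moreover have "2 * D y * r y \<le> L * ((d y)\<^sup>2 + (D y)\<^sup>2)"
    proof -
      have "2 * D y * r y \<le> 2 * \<bar>D y\<bar> * \<bar>r y\<bar>"
        by (metis abs_ge_self abs_mult abs_numeral)
      also have "\<dots> \<le> 2 * \<bar>D y\<bar> * (L * \<bar>d y\<bar>)"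
        by (intro mult_left_mono r y yq) auto
      also have "\<dots> = L * (2 * \<bar>d y\<bar> * \<bar>D y\<bar>)" by simp
      also have "\<dots> \<le> L * (\<bar>d y\<bar>\<^sup>2 + \<bar>D y\<bar>\<^sup>2)"
        using \<open>0 \<le> L\<close> by (intro mult_left_mono sum_squares_bound)
      finally show ?thesis by simp
    qed
    ultimately have "?e' \<le> 0"
      unfolding K_def by (intro mult_nonpos_nonneg) (auto simp: algebra_simps)
    with \<open>(e has_real_derivative ?e') (at y)\<close>
    show "\<exists>z. (e has_real_derivative z) (at y) \<and> z \<le> 0" by blast
  next
    show "continuous_on {p..x} e" unfolding e_def[abs_def]
      by (intro continuous_intros continuous_on_subset[OF cont(1)] continuous_on_subset[OF cont(2)])
        (use x in auto)
  qed
  moreover have "e p = 0" by (simp add: e_def init)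
  ultimately have "((d x)\<^sup>2 + (D x)\<^sup>2) * exp (- K * x) \<le> 0" by (simp add: e_def)
  then have "(d x)\<^sup>2 + (D x)\<^sup>2 \<le> 0" by (simp add: mult_le_0_iff)
  then show ?thesis by (simp add: sum_power2_le_zero_iff)
qed

section \<open>The weight and the right-hand side of the equation\<close>

lemma m_weight_measurable: "m_weight n \<in> borel_measurable Om"
  unfolding m_weight_def[abs_def] by (intro measurable_Om_borel) measurable

lemma L2_m_weight_mult:
  assumes "g \<in> L2" shows "(\<lambda>x. m_weight n x * g x) \<in> L2"
proof -
  have "integrable Om (\<lambda>x. (m_weight n x * g x)\<^sup>2)"
  proof (rule Bochner_Integration.integrable_bound)
    show "integrable Om (\<lambda>x. (g x)\<^sup>2)" using assms by (simp add: L2_def)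
    show "(\<lambda>x. (m_weight n x * g x)\<^sup>2) \<in> borel_measurable Om"
      by (intro borel_measurable_power borel_measurable_times m_weight_measurable L2_measurable assms)
  qed (auto simp: m_weight_def power_mult_distrib)
  then show ?thesis
    using borel_measurable_times[OF m_weight_measurable L2_measurable[OF assms]] by (simp add: L2_def)
qed

lemma source_L2:
  assumes "0 < \<alpha>" "continuous_on {-1..1} v" "\<And>x. x \<in> {-1..1} \<Longrightarrow> 0 \<le> v x"
  shows "(\<lambda>x. lam * v x + m_weight n x * v x powr \<alpha>) \<in> L2"
proof -
  have "continuous_on {-1..1} (\<lambda>x. v x powr \<alpha>)"
    using assms by (intro continuous_on_powr' continuous_on_const) auto
  then show ?thesis using assms(2) by (intro L2_add L2_cmult L2_m_weight_mult continuous_L2)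
qed

section \<open>The explicit profile\<close>

text \<open>The closed lower end treats the critical value, where b = 1, together with the rest. The
  strict upper end means \<omega>/n < pi/2, so the cosine is still positive at 1/n.\<close>

locale flat_profile =
  fixes \<alpha> :: real and n :: nat and lam :: real
  assumes \<alpha>: "0 < \<alpha>" "\<alpha> < 1" and n: "2 \<le> n"
    and lam: "lam_c \<alpha> n \<le> lam" "lam < lam_star n"
begin

definition \<omega> :: real where "\<omega> = sqrt lam"
definition a :: real where "a = 1 / real n"
definition b :: real where "b = b_end \<alpha> n lam"
text \<open>For v = C S^p with S the sine of \<kappa> (b - x), zero energy requires \<kappa> p =
  \<omega>, p (1+\<alpha>) = 2p - 2 and C^(1-\<alpha>) = 2 / ((1+\<alpha>) \<lambda>); this yields
  \<open>\<kappa>\<close>, \<open>p\<close> and \<open>C\<close>.\<close>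

definition \<kappa> :: real where "\<kappa> = (1 - \<alpha>) / 2 * \<omega>"
definition p :: real where "p = 2 / (1 - \<alpha>)"
definition C :: real where "C = (2 / ((1 + \<alpha>) * lam)) powr (1 / (1 - \<alpha>))"
text \<open>The outer branch takes the value C cos(\<omega> a)^p at a, so continuity there demands C
  cos(\<omega> a)^(p-1), and p - 1 = (1+\<alpha>)/(1-\<alpha>).\<close>

definition A :: real where "A = C * cos (\<omega> * a) powr ((1 + \<alpha>) / (1 - \<alpha>))"

text \<open>The truncation \<open>max 0 (b - x)\<close> builds in the zero branch: beyond b the sine
  is 0, and \<open>0 powr p = 0\<close>.\<close>

definition outer :: "real \<Rightarrow> real" where
  "outer x = C * sin (\<kappa> * max 0 (b - x)) powr p"
definition outer' :: "real \<Rightarrow> real" where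
  "outer' x = - (\<omega> * C * sin (\<kappa> * max 0 (b - x)) powr (p - 1) * cos (\<kappa> * max 0 (b - x)))"
definition right :: "real \<Rightarrow> real" where
  "right x = (if x \<le> a then A * cos (\<omega> * x) else outer x)"
definition right' :: "real \<Rightarrow> real" where
  "right' x = (if x \<le> a then - (\<omega> * A * sin (\<omega> * x)) else outer' x)"
definition u :: "real \<Rightarrow> real" where
  "u x = (if x \<le> 0 then right (- x) else right x)"
definition u' :: "real \<Rightarrow> real" where
  "u' x = (if x \<le> 0 then - right' (- x) else right' x)"

section \<open>Relations between the constants\<close>

lemma lam_c_pos: "0 < lam_c \<alpha> n" 
proof -
  have "0 < (1 - \<alpha>) + (1 + \<alpha>) / real n" using \<alpha> by (intro add_pos_nonneg) auto
  then show ?thesis by (simp add: lam_c_def)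
qed

lemma lam_pos: "0 < lam" using lam_c_pos lam by simp

lemma \<omega>_pos: "0 < \<omega>" and \<omega>_sq: "\<omega>\<^sup>2 = lam" using lam_pos by (auto simp: \<omega>_def)

lemma a_pos: "0 < a" and a_le: "a \<le> 1 / 2" using n by (auto simp: a_def field_simps)

lemma \<omega>a: "0 < \<omega> * a" "\<omega> * a < pi / 2"
proof -
  show "0 < \<omega> * a" using \<omega>_pos a_pos by simp
  have "\<omega> < real n * pi / 2"
    unfolding \<omega>_def using lam(2) real_sqrt_less_mono[of lam "(real n * pi / 2)\<^sup>2"] by (simp add: lam_star_def)
  then have "\<omega> * a < real n * pi / 2 * a" using a_pos by (intro mult_strict_right_mono)
  then show "\<omega> * a < pi / 2" using n by (simp add: a_def)
qed

lemma cos_\<omega>a: "0 < cos (\<omega> * a)" using \<omega>a by (intro cos_gt_zero_pi) auto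

lemma b_eq: "b = (pi / \<omega> - (1 + \<alpha>) * a) / (1 - \<alpha>)"
  by (simp add: b_def b_end_def \<omega>_def a_def)

lemma \<kappa>_pos: "0 < \<kappa>" using \<alpha> \<omega>_pos by (simp add: \<kappa>_def)

text \<open>This is the matching condition at 1/n. The two phases are complementary, so sine and
  cosine are exchanged there, and value and slope agree simultaneously.\<close>

lemma \<kappa>_b: "\<kappa> * (b - a) = pi / 2 - \<omega> * a"
proof -
  have "(1 - \<alpha>) * b = pi / \<omega> - (1 + \<alpha>) * a" using \<alpha> by (simp add: b_eq)
  then have "\<omega> * ((1 - \<alpha>) * b) = pi - \<omega> * (1 + \<alpha>) * a"
    using \<omega>_pos by (simp add: right_diff_distrib)
  then show ?thesis by (simp add: \<kappa>_def field_simps)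
qed

lemma a_less_b: "a < b"
proof -
  have "0 < \<kappa> * (b - a)" using \<kappa>_b \<omega>a by simp
  then show ?thesis using \<kappa>_pos by (simp add: zero_less_mult_iff)
qed

text \<open>The condition b = 1 in rearranged form; comparing \<open>lam\<close> with
  \<open>lam_c\<close> then locates b relative to 1.\<close>

lemma \<omega>_c: "pi / sqrt (lam_c \<alpha> n) = (1 - \<alpha>) + (1 + \<alpha>) * a"
proof -
  have "sqrt (lam_c \<alpha> n) = pi / ((1 - \<alpha>) + (1 + \<alpha>) * a)"
    using \<alpha> a_pos unfolding lam_c_def
    by (simp add: real_sqrt_divide a_def)
  then show ?thesis by simp
qed

lemma b_le_1: "b \<le> 1"
proof -
  have "sqrt (lam_c \<alpha> n) \<le> \<omega>" unfolding \<omega>_def using lam by simp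
  then have "pi / \<omega> \<le> pi / sqrt (lam_c \<alpha> n)"
    using lam_c_pos by (intro divide_left_mono) (auto simp: \<omega>_pos)
  then have "pi / \<omega> - (1 + \<alpha>) * a \<le> 1 - \<alpha>" unfolding \<omega>_c by linarith
  then show ?thesis using \<alpha> by (simp add: b_eq)
qed

lemma b_less_1: "lam_c \<alpha> n < lam \<Longrightarrow> b < 1"
proof -
  assume "lam_c \<alpha> n < lam"
  then have "sqrt (lam_c \<alpha> n) < \<omega>" unfolding \<omega>_def by simp
  then have "pi / \<omega> < pi / sqrt (lam_c \<alpha> n)"
    using lam_c_pos by (intro divide_strict_left_mono) (auto simp: \<omega>_pos)
  then have "pi / \<omega> - (1 + \<alpha>) * a < 1 - \<alpha>" unfolding \<omega>_c by linarith
  then show ?thesis using \<alpha> by (simp add: b_eq)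
qed

lemma b_eq_1: "lam = lam_c \<alpha> n \<Longrightarrow> b = 1"
proof -
  assume "lam = lam_c \<alpha> n"
  then have "pi / \<omega> - (1 + \<alpha>) * a = 1 - \<alpha>" using \<omega>_c unfolding \<omega>_def by simp
  then show ?thesis using \<alpha> by (simp add: b_eq)
qed

lemma p_gt_2: "2 < p" using \<alpha> by (simp add: p_def field_simps)

lemma \<kappa>_p: "\<kappa> * p = \<omega>" using \<alpha> by (simp add: \<kappa>_def p_def)

lemma p_minus_2: "p - 2 = p * \<alpha>" "p - 1 = (1 + \<alpha>) / (1 - \<alpha>)"
  using \<alpha> by (auto simp: p_def field_simps)

lemma C_pos: "0 < C" using lam_pos \<alpha> by (simp add: C_def)

lemma A_pos: "0 < A" using C_pos cos_\<omega>a by (simp add: A_def)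

text \<open>As \<alpha>/(1-\<alpha>) = 1/(1-\<alpha>) - 1, one factor of the base splits off. It
  makes the nonlinear term of the outer equation comparable with the linear one.\<close>

lemma C_powr: "C powr \<alpha> = C * lam * (1 + \<alpha>) / 2"
proof -
  define q where "q = 2 / ((1 + \<alpha>) * lam)"
  have q: "0 < q" using lam_pos \<alpha> by (simp add: q_def)
  have "\<alpha> / (1 - \<alpha>) = 1 / (1 - \<alpha>) - 1" using \<alpha> by (simp add: field_simps)
  then have "C powr \<alpha> = q powr (1 / (1 - \<alpha>) - 1)" by (simp add: C_def q_def powr_powr)
  also have "\<dots> = C / q" using q by (simp add: powr_diff C_def q_def)
  finally show ?thesis using lam_pos by (simp add: q_def)
qed

section \<open>The branch beyond 1/n\<close>

lemma sin_outer_pos: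
  assumes "a \<le> x" "x < b" shows "0 < sin (\<kappa> * (b - x))"
proof (rule sin_gt_zero)
  show "0 < \<kappa> * (b - x)" using assms \<kappa>_pos by simp
  have "\<kappa> * (b - x) \<le> \<kappa> * (b - a)" using assms \<kappa>_pos by simp
  also have "\<dots> < pi" using \<kappa>_b \<omega>a pi_gt_zero by linarith
  finally show "\<kappa> * (b - x) < pi" .
qed

lemma outer_pos: "a \<le> x \<Longrightarrow> x < b \<Longrightarrow> 0 < outer x"
  using sin_outer_pos[of x] C_pos by (simp add: outer_def max_def)

lemma outer_eq_0: "b \<le> x \<Longrightarrow> outer x = 0" and outer'_eq_0: "b \<le> x \<Longrightarrow> outer' x = 0"
  using p_gt_2 by (auto simp: outer_def outer'_def max_def)

lemma outer_a: "outer a = A * cos (\<omega> * a)" and outer'_a: "outer' a = - (\<omega> * A * sin (\<omega> * a))"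
proof -
  have m: "max 0 (b - a) = b - a" using a_less_b by simp
  have s: "sin (\<kappa> * (b - a)) = cos (\<omega> * a)" "cos (\<kappa> * (b - a)) = sin (\<omega> * a)"
    unfolding \<kappa>_b by (simp_all add: sin_diff cos_diff)
  have "cos (\<omega> * a) powr p = cos (\<omega> * a) powr (p - 1) * cos (\<omega> * a)"
    using cos_\<omega>a by (simp add: powr_diff)
  then show "outer a = A * cos (\<omega> * a)" unfolding outer_def m s A_def by (simp add: p_minus_2)
  show "outer' a = - (\<omega> * A * sin (\<omega> * a))" unfolding outer'_def m s A_def by (simp add: p_minus_2)
qed

lemma DERIV_outer:
  assumes "a \<le> x" shows "(outer has_real_derivative outer' x) (at x)"
proof -
  consider "x < b" | "x = b" | "b < x" by linarith
  then show ?thesis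
  proof cases
    case 1
    have "((\<lambda>x. C * sin (\<kappa> * (b - x)) powr p) has_real_derivative outer' x) (at x)"
      using sin_outer_pos[OF assms 1] 1 \<kappa>_p \<kappa>_p[unfolded mult.commute[of \<kappa>]]
      by (auto intro!: derivative_eq_intros simp: outer'_def max_def)
    then show ?thesis
      by (rule has_field_derivative_transform_within_open[of _ _ _ "{..<b}"])
        (use 1 in \<open>auto simp: outer_def max_def\<close>)
  next
    case 2
    \<comment> \<open>At b the base of the power is 0. The bound sin t \<le> t gives C \<kappa>^p |y
      - b|^p, and p > 1 is enough for a zero derivative.\<close>
    have "(outer has_real_derivative 0) (at x)"
    proof (rule DERIV_zero_if_powr_bound[where q = p and C = "C * \<kappa> powr p"])
      have "\<forall>\<^sub>F y in at x. a < y"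
        using order_tendstoD(1)[OF tendsto_ident_at, of a x UNIV] 2 a_less_b by simp
      then show "\<forall>\<^sub>F y in at x. \<bar>outer y\<bar> \<le> C * \<kappa> powr p * \<bar>y - x\<bar> powr p"
      proof eventually_elim
        case (elim y)
        show ?case
        proof (cases "y < b")
          case True
          have s: "0 < sin (\<kappa> * (b - y))" using sin_outer_pos True elim by simp
          have "sin (\<kappa> * (b - y)) \<le> \<kappa> * (b - y)"
            using True \<kappa>_pos by (intro sin_x_le_x) auto
          then have "sin (\<kappa> * (b - y)) powr p \<le> (\<kappa> * (b - y)) powr p"
            using p_gt_2 s by (intro powr_mono2) auto
          then have "outer y \<le> C * (\<kappa> * (b - y)) powr p"
            using True C_pos by (auto simp: outer_def max_def intro!: mult_left_mono)
          then show ?thesis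
            using True 2 \<kappa>_pos outer_pos[of y] elim by (simp add: powr_mult mult.assoc)
        qed (use C_pos in \<open>simp add: outer_eq_0\<close>)
      qed
    qed (use 2 p_gt_2 outer_eq_0 in auto)
    then show ?thesis using 2 outer'_eq_0 by simp
  next
    case 3
    have "((\<lambda>_. 0) has_real_derivative outer' x) (at x)" using outer'_eq_0 3 by simp
    then show ?thesis
      by (rule has_field_derivative_transform_within_open[of _ _ _ "{b<..}"])
        (use 3 outer_eq_0 in auto)
  qed
qed

text \<open>Replacing the squared cosine by 1 - S^2 leaves one term in S^(p-2) and one in S^p. As p
  - 2 = p \<alpha>, the first is the nonlinearity; as \<kappa> p = \<omega>, the second is the
  linear term. The point b can join the finite exceptional set of the integration by parts.\<close>

lemma DERIV_outer':
  assumes "a \<le> x" "x \<noteq> b"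
  shows "(outer' has_real_derivative - (lam * outer x - outer x powr \<alpha>)) (at x)"
proof (cases "x < b")
  case True
  let ?\<theta> = "\<kappa> * (b - x)"
  define S where "S = sin ?\<theta>"
  have S: "0 < S" using sin_outer_pos[OF assms(1) True] by (simp add: S_def)
  have Cp: "cos ?\<theta> * cos ?\<theta> = 1 - S\<^sup>2" using sin_cos_squared_add3[of ?\<theta>]
    unfolding S_def power2_eq_square by linarith
  have Sp: "S powr p = S powr (p - 2) * S\<^sup>2" "S powr (p - 1) = S powr (p - 2) * S"
    using S by (simp_all add: powr_diff powr_numeral power2_eq_square)
  have "((\<lambda>x. - (\<omega> * C * sin (\<kappa> * (b - x)) powr (p - 1) * cos (\<kappa> * (b - x)))) has_real_derivative
      \<omega> * C * \<kappa> * ((p - 1) * S powr (p - 2) * (cos ?\<theta> * cos ?\<theta>) - S powr (p - 1) * S)) (at x)"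
    using S unfolding S_def by (auto intro!: derivative_eq_intros simp: algebra_simps)
  moreover have "\<omega> * C * \<kappa> * ((p - 1) * S powr (p - 2) * (cos ?\<theta> * cos ?\<theta>) - S powr (p - 1) * S)
      = - (lam * outer x - outer x powr \<alpha>)"
  proof -
    have o: "outer x = C * S powr p" using True by (simp add: outer_def S_def max_def)
    have "outer x powr \<alpha> = C powr \<alpha> * S powr (p - 2)"
      unfolding o p_minus_2 using C_pos by (simp add: powr_mult powr_powr)
    also have "C powr \<alpha> = \<omega> * C * \<kappa> * (p - 1)"
    proof -
      have "\<kappa> * (p - 1) = \<omega> * (1 + \<alpha>) / 2" 
        unfolding \<kappa>_def p_minus_2 using \<alpha> by (simp add: field_simps)
      then have "\<omega> * C * \<kappa> * (p - 1) = \<omega>\<^sup>2 * C * (1 + \<alpha>) / 2"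
        by (simp add: power2_eq_square mult.assoc)
      moreover have "C powr \<alpha> = \<omega>\<^sup>2 * C * (1 + \<alpha>) / 2" by (simp add: C_powr \<omega>_sq)
      ultimately show ?thesis by (rule trans[OF _ sym, rotated])
    qed
    finally have 1: "outer x powr \<alpha> = \<omega> * C * \<kappa> * (p - 1) * S powr (p - 2)" .
    have 2: "lam * outer x = \<omega> * C * \<kappa> * p * S powr p"
    proof -
      have "\<omega> * C * \<kappa> * p * S powr p = \<omega> * C * (\<kappa> * p) * S powr p" by simp
      also have "\<dots> = \<omega>\<^sup>2 * C * S powr p" by (simp add: \<kappa>_p power2_eq_square)
      finally have "\<omega> * C * \<kappa> * p * S powr p = \<omega>\<^sup>2 * C * S powr p" .
      moreover have "lam * outer x = \<omega>\<^sup>2 * C * S powr p" by (simp add: o \<omega>_sq)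
      ultimately show ?thesis by (rule trans[OF _ sym, rotated])
    qed
    show ?thesis unfolding 1 2 Cp Sp by (simp add: algebra_simps power2_eq_square)
  qed
  ultimately have "((\<lambda>x. - (\<omega> * C * sin (\<kappa> * (b - x)) powr (p - 1) * cos (\<kappa> * (b - x)))) has_real_derivative
      - (lam * outer x - outer x powr \<alpha>)) (at x)" by simp
  then show ?thesis
    by (rule has_field_derivative_transform_within_open[of _ _ _ "{..<b}"])
      (use True in \<open>auto simp: outer'_def max_def\<close>)
next
  case False
  then have "b < x" using assms by simp
  then have "((\<lambda>_. 0) has_real_derivative - (lam * outer x - outer x powr \<alpha>)) (at x)"
    using outer_eq_0 by simp
  then show ?thesis
    by (rule has_field_derivative_transform_within_open[of _ _ _ "{b<..}"])
      (use \<open>b < x\<close> outer'_eq_0 in auto)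
qed

text \<open>For x \<ge> a the sine is nonnegative, as continuity of \<open>powr\<close> at base 0
  requires.\<close>

lemma continuous_outer': "continuous_on {a..} outer'"
proof -
  have "0 \<le> sin (\<kappa> * max 0 (b - x))" if "a \<le> x" for x
    using sin_outer_pos[OF that] by (cases "x < b") (auto simp: max_def)
  then have "continuous_on {a..} (\<lambda>x. sin (\<kappa> * max 0 (b - x)) powr (p - 1))"
    using p_gt_2 by (intro continuous_on_powr' continuous_intros) simp
  moreover have "continuous_on {a..} (\<lambda>x. cos (\<kappa> * max 0 (b - x)))" by (intro continuous_intros)
  ultimately show ?thesis unfolding outer'_def[abs_def]
    by (intro continuous_on_minus continuous_on_mult continuous_on_const)
qed

section \<open>Gluing the two branches at 1/n\<close>

lemma DERIV_inner: "((\<lambda>x. A * cos (\<omega> * x)) has_real_derivative - (\<omega> * A * sin (\<omega> * x))) (at x)"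
  and DERIV_inner': "((\<lambda>x. - (\<omega> * A * sin (\<omega> * x))) has_real_derivative - (lam * (A * cos (\<omega> * x)))) (at x)"
proof -
  show "((\<lambda>x. A * cos (\<omega> * x)) has_real_derivative - (\<omega> * A * sin (\<omega> * x))) (at x)"
    by (auto intro!: derivative_eq_intros)
  have "((\<lambda>x. - (\<omega> * A * sin (\<omega> * x))) has_real_derivative - (\<omega>\<^sup>2 * (A * cos (\<omega> * x)))) (at x)"
    by (auto intro!: derivative_eq_intros simp: power2_eq_square)
  then show "((\<lambda>x. - (\<omega> * A * sin (\<omega> * x))) has_real_derivative - (lam * (A * cos (\<omega> * x)))) (at x)"
    by (simp only: \<omega>_sq)
qed

lemma DERIV_right: "(right has_real_derivative right' x) (at x)"
proof -
  consider "x < a" | "x = a" | "a < x" by linarith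
  then show ?thesis
  proof cases
    case 1
    with DERIV_inner[of x] show ?thesis
      by (auto intro: has_field_derivative_transform_within_open[of _ _ _ "{..<a}"] simp: right_def right'_def)
  next
    case 2
    then show ?thesis
      using DERIV_glue[OF DERIV_inner[of a], of outer] DERIV_outer[of a]
      by (simp add: right_def[abs_def] right'_def outer_a outer'_a)
  next
    case 3
    with DERIV_outer[of x] show ?thesis
      by (auto intro: has_field_derivative_transform_within_open[of _ _ _ "{a<..}"] simp: right_def right'_def)
  qed
qed

lemma DERIV_right':
  assumes "0 < x" "x \<noteq> a" "x \<noteq> b"
  shows "(right' has_real_derivative - (lam * right x + m_weight n x * right x powr \<alpha>)) (at x)"
proof (cases "x < a")
  case True
  then have "m_weight n x = 0" using assms by (simp add: m_weight_def a_def)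
  with True DERIV_inner'[of x] show ?thesis
    by (auto intro: has_field_derivative_transform_within_open[of _ _ _ "{..<a}"] simp: right_def right'_def)
next
  case False
  then have "a < x" using assms by simp
  then have "m_weight n x = -1" using assms by (simp add: m_weight_def a_def)
  with \<open>a < x\<close> DERIV_outer'[of x] assms show ?thesis
    by (auto intro: has_field_derivative_transform_within_open[of _ _ _ "{a<..}"] simp: right_def right'_def)
qed

lemma continuous_right': "continuous_on UNIV right'"
proof -
  have "continuous_on ({..a} \<union> {a..}) right'"
    unfolding right'_def[abs_def]
    by (rule continuous_on_If) (auto intro!: continuous_intros continuous_outer' simp: outer'_a)
  moreover have "{..a} \<union> {a..} = (UNIV :: real set)" by auto
  ultimately show ?thesis by simp
qed

lemma cos_inner_pos:
  assumes "0 \<le> x" "x \<le> a" shows "0 < cos (\<omega> * x)"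
proof (rule cos_gt_zero_pi)
  have "\<omega> * x \<le> \<omega> * a" using assms \<omega>_pos by simp
  then show "\<omega> * x < pi / 2" using \<omega>a by simp
  have "0 \<le> \<omega> * x" using assms \<omega>_pos by simp
  then show "- (pi / 2) < \<omega> * x" using pi_gt_zero by linarith
qed

lemma right_pos: "0 \<le> x \<Longrightarrow> x < b \<Longrightarrow> 0 < right x"
  using A_pos cos_inner_pos[of x] outer_pos[of x] by (auto simp: right_def)

lemma right_nonneg: "0 \<le> x \<Longrightarrow> 0 \<le> right x"
  using right_pos[of x] outer_eq_0[of x] a_less_b by (cases "x < b") (auto simp: right_def)

lemma right_le: "0 \<le> x \<Longrightarrow> right x \<le> A"
proof (cases "x \<le> a")
  case False
  assume "0 \<le> x"
  have "sin (\<kappa> * max 0 (b - x)) \<le> sin (\<kappa> * (b - a))"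
  proof (rule sin_monotone_2pi_le)
    show "\<kappa> * max 0 (b - x) \<le> \<kappa> * (b - a)" using False a_less_b \<kappa>_pos by simp
    show "- (pi / 2) \<le> \<kappa> * max 0 (b - x)"
      using \<kappa>_pos pi_gt_zero by (smt (verit) mult_nonneg_nonneg half_gt_zero max.cobounded1)
    show "\<kappa> * (b - a) \<le> pi / 2" using \<kappa>_b \<omega>a by simp
  qed
  moreover have "0 \<le> sin (\<kappa> * max 0 (b - x))"
    using sin_outer_pos[of x] False by (cases "x < b") (auto simp: max_def)
  ultimately have "outer x \<le> outer a"
    unfolding outer_def using C_pos p_gt_2 a_less_b
    by (intro mult_left_mono powr_mono2) auto
  also have "\<dots> \<le> A" using A_pos by (simp add: outer_a)
  finally show ?thesis using False by (simp add: right_def)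
qed (use A_pos in \<open>simp add: right_def\<close>)

section \<open>The even extension is a weak solution\<close>

lemma u_abs: "u x = right \<bar>x\<bar>" by (simp add: u_def)

lemma DERIV_u: "(u has_real_derivative u' x) (at x)"
proof -
  have l: "((\<lambda>x. right (- x)) has_real_derivative - right' (- x)) (at x)" for x
    using DERIV_right[of "- x"] by (simp only: DERIV_mirror)
  consider "x < 0" | "x = 0" | "0 < x" by linarith
  then show ?thesis
  proof cases
    case 1
    with l[of x] show ?thesis
      by (auto intro: has_field_derivative_transform_within_open[of _ _ _ "{..<0}"] simp: u_def u'_def)
  next
    case 2
    \<comment> \<open>The cosine has slope 0 at the origin, so reflection creates no corner.\<close>
    have "right' 0 = 0" using a_pos by (simp add: right'_def)
    then show ?thesis
      using DERIV_glue[OF l[of 0], of right] DERIV_right[of 0] 2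
      by (simp add: u_def[abs_def] u'_def)
  next
    case 3
    with DERIV_right[of x] show ?thesis
      by (auto intro: has_field_derivative_transform_within_open[of _ _ _ "{0<..}"] simp: u_def u'_def)
  qed
qed

lemma continuous_u': "continuous_on UNIV u'"
proof -
  have "right' 0 = 0" using a_pos by (simp add: right'_def)
  then have "continuous_on ({..0} \<union> {0..}) u'"
    unfolding u'_def[abs_def]
    by (intro continuous_on_If continuous_intros continuous_on_subset[OF continuous_right']
        continuous_on_compose2[OF continuous_right']) auto
  moreover have "{..0} \<union> {0..} = (UNIV :: real set)" by auto
  ultimately show ?thesis by simp
qed

lemma DERIV_u':
  assumes "x \<notin> {-b, -a, 0, a, b}"
  shows "(u' has_real_derivative - (lam * u x + m_weight n x * u x powr \<alpha>)) (at x)"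
proof (cases "0 < x")
  case True
  with DERIV_right'[of x] assms show ?thesis
    by (auto intro: has_field_derivative_transform_within_open[of _ _ _ "{0<..}"] simp: u_def u'_def)
next
  case False
  then have x: "0 < - x" using assms by auto
  have "(right' has_real_derivative - (lam * right (-x) + m_weight n (-x) * right (-x) powr \<alpha>)) (at (- x))"
    by (rule DERIV_right'[OF x]) (use assms in auto)
  note DERIV_minus[OF DERIV_mirror[THEN iffD1, OF this]]
  then have "((\<lambda>x. - right' (- x)) has_real_derivative
      - (lam * right (-x) + m_weight n (-x) * right (-x) powr \<alpha>)) (at x)" by (simp only: minus_minus)
  then show ?thesis using x
    by (auto intro: has_field_derivative_transform_within_open[of _ _ _ "{..<0}"]
        simp: u_def u'_def m_weight_def)
qed

lemma continuous_u: "continuous_on S u"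
  using DERIV_u DERIV_isCont continuous_at_imp_continuous_on by blast

lemma u_nonneg: "0 \<le> u x" and u_le: "u x \<le> A" and u_pos: "\<bar>x\<bar> < b \<Longrightarrow> 0 < u x"
  by (auto simp: u_abs intro: right_nonneg right_le right_pos)

lemma u_eq_0: "b \<le> \<bar>x\<bar> \<Longrightarrow> u x = 0"
  using outer_eq_0 a_less_b by (simp add: u_abs right_def)

lemma u_even: "u (- x) = u x" by (simp add: u_abs)

lemma u_0: "u 0 = A" using a_pos by (simp add: u_abs right_def)

lemma u_H10: "u \<in> H10"
  by (rule H10_flat_C1[OF DERIV_u continuous_u']) (use u_eq_0 b_le_1 in auto)

lemma wderiv_u: "AE x in Om. wderiv u x = u' x" "wderiv u \<in> L2"
  using C1_wderiv[OF DERIV_u continuous_u'] by auto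

lemma source_u_L2: "(\<lambda>x. lam * u x + m_weight n x * u x powr \<alpha>) \<in> L2"
  by (intro source_L2 \<alpha> continuous_u u_nonneg)

lemma u_solution: "nonneg_solution \<alpha> n lam u"
  unfolding nonneg_solution_def
proof (intro conjI ballI)
  fix v assume v: "v \<in> H10"
  have c: "continuous_on {-1..1} u'" by (rule continuous_on_subset[OF continuous_u']) simp
  have "(\<integral>x. wderiv u x * wderiv v x \<partial>Om) = (\<integral>x. u' x * wderiv v x \<partial>Om)"
    by (intro integral_cong_AE borel_measurable_times L2_measurable wderiv_u H1_wderiv continuous_L2 c)
      (use v wderiv_u(1) in \<open>auto simp: H10_def\<close>)
  also have "\<dots> = (\<integral>x. (lam * u x + m_weight n x * u x powr \<alpha>) * v x \<partial>Om)"
    by (rule H10_integration_by_parts[OF c source_u_L2, of "{-b, -a, 0, a, b}"])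
      (use DERIV_u' v in auto)
  finally show "(\<integral>x. wderiv u x * wderiv v x \<partial>Om) = \<dots>" .
qed (use u_H10 continuous_u u_nonneg in auto)

end

section \<open>Uniqueness\<close>

text \<open>If the essential supremum were below some z < m, the continuous function max 0 (|u| - z)
  would vanish almost everywhere, hence also at \<open>x0\<close>.\<close>

lemma Linf_norm_continuous:
  assumes "continuous_on UNIV u" and le: "\<And>x. x \<in> {-1<..<1} \<Longrightarrow> \<bar>u x\<bar> \<le> m"
    and x0: "x0 \<in> {-1<..<1}" "\<bar>u x0\<bar> = m"
  shows "Linf_norm u = m"
proof -
  have meas: "(\<lambda>x. ereal \<bar>u x\<bar>) \<in> borel_measurable Om"
    using continuous_measurable_Om[OF assms(1)] by measurable
  let ?E = "esssup Om (\<lambda>x. ereal \<bar>u x\<bar>)"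
  have "?E \<le> ereal m"
    by (rule esssup_I[OF meas]) (rule AE_I2, use le in simp)
  moreover have "\<not> ?E < ereal m"
  proof
    assume "?E < ereal m"
    then obtain z where z: "?E < ereal z" "z < m" using ereal_dense2[of ?E "ereal m"] by auto
    have "AE x in Om. max 0 (\<bar>u x\<bar> - z) = 0"
      using esssup_AE[of "\<lambda>x. ereal \<bar>u x\<bar>" Om]
    proof eventually_elim
      case (elim x)
      then have "ereal \<bar>u x\<bar> < ereal z" using z(1) by (rule le_less_trans)
      then show ?case by simp
    qed
    moreover have "continuous_on {-1<..<1} (\<lambda>x. max 0 (\<bar>u x\<bar> - z))"
      by (intro continuous_intros continuous_on_subset[OF assms(1)]) simp
    ultimately have "max 0 (\<bar>u x0\<bar> - z) = 0" by (intro continuous_on_AE_zero x0)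
    then show False using z x0 by simp
  qed
  ultimately have "?E = ereal m" by (simp add: less_le)
  then show ?thesis by (simp add: Linf_norm_def)
qed

text \<open>V is a constant minus the primitive of the right-hand side. The latter is continuous
  except where the weight jumps, so V is differentiable away from |x| = 1/n.\<close>

lemma nonneg_solution_classical:
  assumes "0 < \<alpha>" and sol: "nonneg_solution \<alpha> n lam v"
  obtains V where "continuous_on {-1..1} V"
    "\<And>x. x \<in> {-1<..<1} \<Longrightarrow> (v has_real_derivative V x) (at x)"
    "\<And>x. x \<in> {-1<..<1} \<Longrightarrow> \<bar>x\<bar> \<noteq> 1 / real n \<Longrightarrow>
      (V has_real_derivative - (lam * v x + m_weight n x * v x powr \<alpha>)) (at x)"
proof -
  define f where "f x = lam * v x + m_weight n x * v x powr \<alpha>" for x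
  define F where "F x = integral {-1..x} f" for x
  define S where "S = {- (1 / real n), 1 / real n}"
  have v: "v \<in> H10" "continuous_on {-1..1} v" "\<And>x. x \<in> {-1..1} \<Longrightarrow> 0 \<le> v x"
    and weak: "\<And>\<phi>. \<phi> \<in> H10 \<Longrightarrow> (\<integral>x. wderiv v x * wderiv \<phi> x \<partial>Om) = (\<integral>x. f x * \<phi> x \<partial>Om)"
    using sol by (auto simp: nonneg_solution_def f_def)
  have vH: "v \<in> H1" using v(1) by (simp add: H10_def)
  have fL: "f \<in> L2" unfolding f_def[abs_def] by (rule source_L2[OF assms(1) v(2,3)])
  have "f integrable_on {-1<..<1}"
    using L2_integrable[OF fL] by (intro integrable_on_lebesgue_on) auto
  then have fint: "f integrable_on {-1..1}" by (simp add: integrable_on_Icc_iff_Ioo)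
  have cF: "continuous_on {-1..1} F"
    unfolding F_def[abs_def] by (rule indefinite_integral_continuous_1[OF fint])
  have cont: "isCont f x" if "x \<in> {-1<..<1} - S" for x
  proof -
    have xv: "isCont v x" using continuous_on_interior[OF v(2)] that
      by (simp add: interior_atLeastAtMost_real)
    have ev: "\<forall>\<^sub>F y in at x. y \<in> {-1<..<1}"
      by (rule eventually_at_in_open') (use that in auto)
    \<comment> \<open>At a zero of v this rests on \<alpha> > 0 and on v being nonnegative
      nearby.\<close>
    have "((\<lambda>y. v y powr \<alpha>) \<longlongrightarrow> v x powr \<alpha>) (at x)"
      using xv \<open>0 < \<alpha>\<close> unfolding isCont_def
      by (intro tendsto_powr' tendsto_const) (auto intro!: eventually_mono[OF ev] v(3))
    moreover have "(m_weight n \<longlongrightarrow> m_weight n x) (at x)"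
    proof (rule tendsto_eventually)
      have "open ({..< - (1 / real n)} \<union> {- (1 / real n)<..<1 / real n} \<union> {1 / real n<..})"
        by (intro open_Un open_lessThan open_greaterThanLessThan open_greaterThan)
      moreover have "x \<in> {..< - (1 / real n)} \<union> {- (1 / real n)<..<1 / real n} \<union> {1 / real n<..}"
        using that by (auto simp: S_def)
      moreover define W where "W = (if \<bar>x\<bar> < 1 / real n then {- (1 / real n)<..<1 / real n}
        else {..< - (1 / real n)} \<union> {1 / real n<..})"
      ultimately have "open W" "x \<in> W" by (auto simp: W_def abs_if split: if_splits)
      then show "\<forall>\<^sub>F y in at x. m_weight n y = m_weight n x"
        unfolding eventually_at_topological
        by (intro exI[of _ W]) (auto simp: W_def m_weight_def abs_if split: if_splits)
    qed
    ultimately show ?thesis using xv unfolding isCont_def f_def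
      by (intro tendsto_add tendsto_mult tendsto_const)
  qed
  have dF: "(F has_real_derivative f x) (at x)" if "x \<in> {-1<..<1} - S" for x
  proof -
    have "((\<lambda>u. integral {-1..u} f) has_vector_derivative f x) (at x within ({-1..1} - {}))"
      by (rule integral_has_vector_derivative_continuous_at[OF fint])
        (use that in \<open>auto intro!: continuous_at_imp_continuous_within cont\<close>)
    moreover have "at x within {-1..1} = at x"
      by (rule at_within_interior) (use that in \<open>simp add: interior_atLeastAtMost_real\<close>)
    ultimately show ?thesis
      by (simp add: has_real_derivative_iff_has_vector_derivative F_def[abs_def])
  qed
  have "(\<integral>x. wderiv v x * deriv \<phi> x \<partial>Om) = (\<integral>x. f x * \<phi> x \<partial>Om)" if \<phi>: "\<phi> \<in> C1c" for \<phi>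
  proof -
    have "(\<integral>x. wderiv v x * deriv \<phi> x \<partial>Om) = (\<integral>x. wderiv v x * wderiv \<phi> x \<partial>Om)"
      by (intro integral_cong_AE borel_measurable_times L2_measurable H1_wderiv vH C1c_deriv_L2
          C1c_wderiv \<phi>) (use C1c_wderiv(2)[OF \<phi>] in auto)
    also have "\<dots> = (\<integral>x. f x * \<phi> x \<partial>Om)" by (rule weak[OF C1c_H10[OF \<phi>]])
    finally show ?thesis .
  qed
  then obtain c where c: "\<And>x. x \<in> {-1<..<1} \<Longrightarrow> (v has_real_derivative c - F x) (at x)"
    using weak_solution_C1[OF vH v(2) fL cF, of S] dF by (auto simp: S_def)
  show thesis
  proof (rule that[of "\<lambda>x. c - F x"])
    show "continuous_on {-1..1} (\<lambda>x. c - F x)" by (intro continuous_intros cF)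
    show "((\<lambda>x. c - F x) has_real_derivative - (lam * v x + m_weight n x * v x powr \<alpha>)) (at x)"
      if "x \<in> {-1<..<1}" "\<bar>x\<bar> \<noteq> 1 / real n" for x
    proof -
      have "x \<in> {-1<..<1} - S" using that by (auto simp: S_def)
      from DERIV_diff[OF DERIV_const dF[OF this], of c] show ?thesis by (simp add: f_def)
    qed
  qed (rule c)
qed

context flat_profile
begin

section \<open>Norm, support and functionals of the profile\<close>

lemma Linf_u: "Linf_norm u = A"
  by (rule Linf_norm_continuous[OF continuous_u, of _ 0]) (use u_nonneg u_le u_0 A_pos in auto)

lemma u_positive_flat: "lam = lam_c \<alpha> n \<Longrightarrow> positive_flat u"
proof -
  assume "lam = lam_c \<alpha> n"
  then have b: "b = 1" by (rule b_eq_1)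
  have "right' 1 = 0" using a_less_b b outer'_eq_0[of 1] by (simp add: right'_def)
  then have "u' 1 = 0" "u' (-1) = 0" by (auto simp: u'_def)
  then show ?thesis
    unfolding positive_flat_def
    using u_pos u_eq_0 b DERIV_u[of 1] DERIV_u[of "-1"]
    by (auto intro: has_field_derivative_at_within)
qed

lemma b_pos: "0 < b" using a_pos a_less_b by simp

lemma supp_u: "supp u = {-b..b}"
proof -
  have "{x \<in> {-1<..<1}. u x \<noteq> 0} = {-b<..<b}"
  proof (intro set_eqI iffI)
    fix x assume "x \<in> {x \<in> {-1<..<1}. u x \<noteq> 0}"
    then have "\<bar>x\<bar> < b" using u_eq_0[of x] by force
    then show "x \<in> {-b<..<b}" by auto
  next
    fix x assume "x \<in> {-b<..<b}"
    then have "\<bar>x\<bar> < b" by auto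
    then show "x \<in> {x \<in> {-1<..<1}. u x \<noteq> 0}" using u_pos[of x] b_le_1 by auto
  qed
  then show ?thesis using b_pos by (simp add: supp_def)
qed

lemma M_u_neg: "M \<alpha> n u < 0"
proof -
  define g where "g x = u x powr (\<alpha> + 1)" for x
  have cg: "continuous_on UNIV g"
    unfolding g_def[abs_def] using u_nonneg \<alpha>
    by (intro continuous_on_powr' continuous_u continuous_on_const) auto
  have gL: "g \<in> L2" by (intro continuous_L2 continuous_on_subset[OF cg]) simp
  have int: "integrable Om (\<lambda>x. - (m_weight n x * g x))"
    by (intro Bochner_Integration.integrable_minus L2_integrable L2_m_weight_mult gL)
  have nonneg: "0 \<le> - (m_weight n x * g x)" for x by (simp add: m_weight_def g_def)
  have M: "M \<alpha> n u = - (\<integral>x. - (m_weight n x * g x) \<partial>Om)"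
    unfolding M_def g_def using u_nonneg by simp
  have "0 \<le> (\<integral>x. - (m_weight n x * g x) \<partial>Om)"
    by (intro Bochner_Integration.integral_nonneg nonneg)
  moreover have "(\<integral>x. - (m_weight n x * g x) \<partial>Om) \<noteq> 0"
  proof
    assume "(\<integral>x. - (m_weight n x * g x) \<partial>Om) = 0"
    then have "AE x in Om. - (m_weight n x * g x) = 0"
      using integral_nonneg_eq_0_iff_AE[OF int] nonneg by simp
    \<comment> \<open>The weight is discontinuous; max 0 (|x| - a) is a continuous substitute that
      vanishes wherever the weight does, so equality can be tested at a single point between a and
      b.\<close>
    then have "AE x in Om. max 0 (\<bar>x\<bar> - a) * g x = 0"
      by eventually_elim (auto simp: m_weight_def a_def split: if_splits)
    moreover have "continuous_on {-1<..<1} (\<lambda>x. max 0 (\<bar>x\<bar> - a) * g x)"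
      by (intro continuous_intros continuous_on_subset[OF cg]) simp
    moreover have mid: "(a + b) / 2 \<in> {-1<..<1}" "\<bar>(a + b) / 2\<bar> < b" "a < \<bar>(a + b) / 2\<bar>"
      using a_pos a_less_b b_le_1 by auto
    ultimately have "max 0 (\<bar>(a + b) / 2\<bar> - a) * g ((a + b) / 2) = 0"
      by (intro continuous_on_AE_zero)
    then show False using u_pos[OF mid(2)] mid(3) by (simp add: g_def)
  qed
  ultimately show ?thesis using M by simp
qed

lemma H_u_eq_M: "H lam u = M \<alpha> n u"
proof -
  note uL = continuous_L2[OF continuous_u]
  have c: "continuous_on {-1..1} (\<lambda>x. u x powr \<alpha>)"
    using u_nonneg \<alpha> by (intro continuous_on_powr' continuous_u continuous_on_const) auto
  have powr: "\<bar>u x\<bar> powr (\<alpha> + 1) = u x powr \<alpha> * u x" for x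
    using u_nonneg[of x] by (cases "u x = 0") (auto simp: powr_add)
  have int: "integrable Om (\<lambda>x. wderiv u x * wderiv u x)" "integrable Om (\<lambda>x. u x * u x)"
    "integrable Om (\<lambda>x. m_weight n x * u x powr \<alpha> * u x)"
    by (intro L2_mult_integrable wderiv_u uL L2_m_weight_mult continuous_L2[OF c])+
  have "H lam u = (\<integral>x. wderiv u x * wderiv u x \<partial>Om) - lam * (\<integral>x. u x * u x \<partial>Om)"
    using int unfolding H_def power2_abs power2_eq_square by simp
  also have "(\<integral>x. wderiv u x * wderiv u x \<partial>Om)
      = (\<integral>x. (lam * u x + m_weight n x * u x powr \<alpha>) * u x \<partial>Om)"
    using u_solution u_H10 by (simp add: nonneg_solution_def)
  also have "\<dots> = (\<integral>x. lam * (u x * u x) + m_weight n x * u x powr \<alpha> * u x \<partial>Om)"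
    by (simp add: distrib_right mult.assoc)
  also have "\<dots> = lam * (\<integral>x. u x * u x \<partial>Om) + (\<integral>x. m_weight n x * u x powr \<alpha> * u x \<partial>Om)"
    using int by simp
  also have "(\<integral>x. m_weight n x * u x powr \<alpha> * u x \<partial>Om) = M \<alpha> n u"
    by (simp add: M_def powr mult.assoc)
  finally show ?thesis by simp
qed

text \<open>Because H = M, both functionals are multiples of M < 0. The coefficient 1/2 -
  1/(\<alpha>+1) is negative and 1 - \<alpha> is positive, both by \<alpha> < 1.\<close>

lemma E_u_pos: "0 < E \<alpha> n lam u" and E''_u_neg: "E'' \<alpha> n lam u < 0"
proof -
  have "E \<alpha> n lam u = (1 / 2 - 1 / (\<alpha> + 1)) * M \<alpha> n u"
    unfolding E_def H_u_eq_M by (simp add: left_diff_distrib)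
  moreover have "1 / 2 - 1 / (\<alpha> + 1) < 0" using \<alpha> by (simp add: field_simps)
  ultimately show "0 < E \<alpha> n lam u" using M_u_neg by (simp add: mult_neg_neg)
  have "E'' \<alpha> n lam u = (1 - \<alpha>) * M \<alpha> n u"
    unfolding E''_def H_u_eq_M by (simp add: left_diff_distrib)
  then show "E'' \<alpha> n lam u < 0" using M_u_neg \<alpha> by (simp add: mult_pos_neg)
qed

text \<open>The energy \<open>v'\<^sup>2 + \<lambda> v\<^sup>2 - 2 v\<^bsup>1+\<alpha>\<^esup> / (1+\<alpha>)\<close> is constant on \<open>[1/n,1]\<close> and vanishes beyond
  \<open>b\<close>, which fixes the value at the centre.\<close>

lemma solution_at_centre:
  assumes "b < 1"
    and cv: "continuous_on {-1..1} v" and v0: "\<And>x. x \<in> {-1..1} \<Longrightarrow> 0 \<le> v x"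
    and cV: "continuous_on {-1..1} V"
    and dv: "\<And>x. x \<in> {-1<..<1} \<Longrightarrow> (v has_real_derivative V x) (at x)"
    and dV: "\<And>x. x \<in> {-1<..<1} \<Longrightarrow> \<bar>x\<bar> \<noteq> a \<Longrightarrow>
      (V has_real_derivative - (lam * v x + m_weight n x * v x powr \<alpha>)) (at x)"
    and zero: "\<And>x. b < x \<Longrightarrow> x < 1 \<Longrightarrow> v x = 0"
    and va: "v a = B * cos (\<omega> * a)" "V a = - (\<omega> * B * sin (\<omega> * a))" and "0 < B"
  shows "B = A"
proof -
  define en where "en x = (V x)\<^sup>2 + lam * (v x)\<^sup>2 - 2 / (1 + \<alpha>) * v x powr (1 + \<alpha>)" for x
  \<comment> \<open>Any point strictly between b and 1 would do: v is 0 in a whole neighbourhood, so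
    both v and V vanish there.\<close>
  define y where "y = (b + 1) / 2"
  have y: "b < y" "y < 1" "a < y" using \<open>b < 1\<close> a_less_b by (auto simp: y_def)
  have sub: "{a..y} \<subseteq> {-1..1}" using y a_pos by auto
  have "en y = en a"
  proof (rule DERIV_isconst_end[OF y(3)])
    show "continuous_on {a..y} en" unfolding en_def[abs_def]
      using v0 sub \<alpha>
      by (intro continuous_intros continuous_on_powr' continuous_on_subset[OF cV sub]
          continuous_on_subset[OF cv sub]) auto
    fix x assume x: "a < x" "x < y"
    then have x1: "x \<in> {-1<..<1}" "\<bar>x\<bar> \<noteq> a" using y a_pos by auto
    have m: "m_weight n x = -1" using x by (simp add: m_weight_def a_def)
    \<comment> \<open>The solution is not yet known to be positive on (a,y), so the power is
      differentiated by the rule that admits zeros of a nonnegative base.\<close>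
    have dp: "((\<lambda>x. v x powr (1 + \<alpha>)) has_real_derivative (1 + \<alpha>) * v x powr (1 + \<alpha> - 1) * V x) (at x)"
      by (rule DERIV_powr_nonneg[OF _ dv[OF x1(1)], of _ "min (1 - x) (1 + x)"])
        (use x1 \<alpha> in \<open>auto intro!: v0\<close>)
    have "(en has_real_derivative 2 * V x * - (lam * v x + m_weight n x * v x powr \<alpha>)
        + lam * (2 * v x * V x) - 2 / (1 + \<alpha>) * ((1 + \<alpha>) * v x powr (1 + \<alpha> - 1) * V x)) (at x)"
      unfolding en_def[abs_def]
      by (rule derivative_eq_intros refl dV[OF x1] dv[OF x1(1)] dp)+ simp
    moreover have "2 * V x * - (lam * v x + m_weight n x * v x powr \<alpha>)
        + lam * (2 * v x * V x) - 2 / (1 + \<alpha>) * ((1 + \<alpha>) * v x powr (1 + \<alpha> - 1) * V x) = 0"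
    proof -
      have "2 / (1 + \<alpha>) * ((1 + \<alpha>) * v x powr (1 + \<alpha> - 1) * V x) = 2 * v x powr \<alpha> * V x"
        using \<alpha> by (simp add: divide_simps)
      then show ?thesis by (simp add: m algebra_simps)
    qed
    ultimately show "DERIV en x :> 0" by simp
  qed
  moreover have "en y = 0"
  proof -
    have vy: "v y = 0" using zero y by simp
    have "((\<lambda>_. 0) has_real_derivative V y) (at y)"
      by (rule has_field_derivative_transform_within_open[OF dv, of _ "{b<..<1}"])
        (use y zero a_pos in auto)
    then have "V y = 0" using DERIV_unique DERIV_const by blast
    then show ?thesis using vy by (simp add: en_def)
  qed
  ultimately have en: "en a = 0" by simp
  define c where "c = cos (\<omega> * a)"
  have c: "0 < c" using cos_\<omega>a by (simp add: c_def)
  have "(V a)\<^sup>2 = \<omega>\<^sup>2 * B\<^sup>2 * (sin (\<omega> * a))\<^sup>2" by (simp add: va power_mult_distrib)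
  then have "(V a)\<^sup>2 + lam * (v a)\<^sup>2 = lam * B\<^sup>2 * ((sin (\<omega> * a))\<^sup>2 + (cos (\<omega> * a))\<^sup>2)"
    unfolding \<omega>_sq by (simp only: va power_mult_distrib distrib_left mult.assoc)
  then have "(V a)\<^sup>2 + lam * (v a)\<^sup>2 = lam * B\<^sup>2" by simp
  then have eq: "lam * B\<^sup>2 = 2 / (1 + \<alpha>) * (B powr (1 + \<alpha>) * c powr (1 + \<alpha>))"
    using en \<open>0 < B\<close> c by (simp add: en_def va c_def powr_mult)
  \<comment> \<open>Zero energy at a reads \<lambda> B^2 = 2/(1+\<alpha>) (B c)^(1+\<alpha>).
    Cancelling B^(1+\<alpha>) leaves B^(1-\<alpha>), and the power 1/(1-\<alpha>) returns
    \<open>A\<close>.\<close>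
  have B2: "B\<^sup>2 = B powr (1 - \<alpha>) * B powr (1 + \<alpha>)"
    using \<open>0 < B\<close> by (simp add: powr_add[symmetric])
  have "B powr (1 - \<alpha>) * lam * B powr (1 + \<alpha>) = 2 / (1 + \<alpha>) * c powr (1 + \<alpha>) * B powr (1 + \<alpha>)"
    using eq unfolding B2 by (simp add: mult_ac)
  then have "B powr (1 - \<alpha>) * lam = 2 / (1 + \<alpha>) * c powr (1 + \<alpha>)"
    using \<open>0 < B\<close> by (subst (asm) mult_right_cancel) auto
  then have "B powr (1 - \<alpha>) = 2 / ((1 + \<alpha>) * lam) * c powr (1 + \<alpha>)"
  proof -
    assume "B powr (1 - \<alpha>) * lam = 2 / (1 + \<alpha>) * c powr (1 + \<alpha>)"
    then have "B powr (1 - \<alpha>) = 2 / (1 + \<alpha>) * c powr (1 + \<alpha>) / lam"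
      using lam_pos by (subst eq_divide_eq) simp
    then show ?thesis by simp
  qed
  then have "(B powr (1 - \<alpha>)) powr (1 / (1 - \<alpha>)) = (2 / ((1 + \<alpha>) * lam) * c powr (1 + \<alpha>)) powr (1 / (1 - \<alpha>))"
    by simp
  also have "\<dots> = A"
    using lam_pos \<alpha> c by (subst powr_mult) (auto simp: powr_powr A_def C_def c_def)
  finally show "B = A" using \<open>0 < B\<close> \<alpha> by (simp add: powr_powr)
qed

lemma solution_unique:
  assumes "b < 1" and sol: "nonneg_solution \<alpha> n lam v" and even: "even_on_interval v"
    and supp: "supp v = {-b..b}" and x: "x \<in> {-1..1}"
  shows "v x = u x"
proof -
  have cv: "continuous_on {-1..1} v" and v0: "\<And>x. x \<in> {-1..1} \<Longrightarrow> 0 \<le> v x"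
    using sol by (auto simp: nonneg_solution_def)
  obtain V where cV: "continuous_on {-1..1} V"
    and dv: "\<And>x. x \<in> {-1<..<1} \<Longrightarrow> (v has_real_derivative V x) (at x)"
    and dV: "\<And>x. x \<in> {-1<..<1} \<Longrightarrow> \<bar>x\<bar> \<noteq> a \<Longrightarrow>
      (V has_real_derivative - (lam * v x + m_weight n x * v x powr \<alpha>)) (at x)"
    using nonneg_solution_classical[OF \<alpha>(1) sol] unfolding a_def by metis
  have zero: "v x = 0" if "b < x" "x < 1" for x
  proof (rule ccontr)
    assume "v x \<noteq> 0"
    then have "x \<in> supp v" unfolding supp_def
      by (intro subsetD[OF closure_subset]) (use that b_pos in auto)
    then show False using that supp by simp
  qed
  \<comment> \<open>The derivative of an even function is odd. With the value B at 0 this completes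
    the initial data of the cosine.\<close>
  have V0: "V 0 = 0"
  proof -
    have "((\<lambda>x. v (- x)) has_real_derivative - V 0) (at 0)"
      unfolding DERIV_mirror[symmetric] using dv[of 0] by simp
    then have "(v has_real_derivative - V 0) (at 0)"
      by (rule has_field_derivative_transform_within_open[of _ _ _ "{-1<..<1}"])
        (use even in \<open>auto simp: even_on_interval_def\<close>)
    then have "- V 0 = V 0" by (rule DERIV_unique) (rule dv, simp)
    then show ?thesis by simp
  qed
  define B where "B = v 0"
  have inner: "v x - B * cos (\<omega> * x) = 0 \<and> V x + \<omega> * B * sin (\<omega> * x) = 0" if "0 \<le> x" "x \<le> a" for x
  proof (rule second_order_zero[where p = 0 and q = a and x = x and L = lam and
        d = "\<lambda>x. v x - B * cos (\<omega> * x)" and D = "\<lambda>x. V x + \<omega> * B * sin (\<omega> * x)"])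
    have sub: "{0..a} \<subseteq> {-1..1}" using a_le by auto
    show "continuous_on {0..a} (\<lambda>x. v x - B * cos (\<omega> * x))"
      "continuous_on {0..a} (\<lambda>x. V x + \<omega> * B * sin (\<omega> * x))"
      by (intro continuous_intros continuous_on_subset[OF cv sub] continuous_on_subset[OF cV sub])+
    fix y assume y: "0 < y" "y < a"
    then have y1: "y \<in> {-1<..<1}" "\<bar>y\<bar> \<noteq> a" and m: "m_weight n y = 0"
      using a_le by (auto simp: m_weight_def a_def)
    show "((\<lambda>x. v x - B * cos (\<omega> * x)) has_real_derivative V y + \<omega> * B * sin (\<omega> * y)) (at y)"
      by (rule derivative_eq_intros refl dv[OF y1(1)])+ simp
    show "((\<lambda>x. V x + \<omega> * B * sin (\<omega> * x)) has_real_derivative - lam * v y + \<omega>\<^sup>2 * (B * cos (\<omega> * y))) (at y)"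
      by (rule derivative_eq_intros refl dV[OF y1])+ (simp add: m power2_eq_square)
    show "\<bar>- lam * v y + \<omega>\<^sup>2 * (B * cos (\<omega> * y))\<bar> \<le> lam * \<bar>v y - B * cos (\<omega> * y)\<bar>"
    proof -
      have "- lam * v y + \<omega>\<^sup>2 * (B * cos (\<omega> * y)) = - (lam * (v y - B * cos (\<omega> * y)))"
        by (simp add: \<omega>_sq right_diff_distrib)
      then show ?thesis using lam_pos by (simp only: abs_minus_cancel abs_mult)
    qed
  qed (use that V0 lam_pos in \<open>auto simp: B_def\<close>)
  \<comment> \<open>If B = 0, v would vanish on (-a,a), although 0 belongs to the support.\<close>
  have "B \<noteq> 0"
  proof
    assume B: "B = 0"
    have "v x = 0" if "x \<in> {-a<..<a}" for x
    proof -
      have "v \<bar>x\<bar> = 0" using inner[of "\<bar>x\<bar>"] that B by auto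
      moreover have "v \<bar>x\<bar> = v x"
        using even that a_le by (auto simp: even_on_interval_def abs_if)
      ultimately show ?thesis by simp
    qed
    then have "{-a<..<a} \<inter> {x \<in> {-1<..<1}. v x \<noteq> 0} = {}" by auto
    then have "{-a<..<a} \<inter> supp v = {}"
      unfolding supp_def by (subst open_Int_closure_eq_empty) auto
    moreover have "0 \<in> {-a<..<a} \<inter> supp v" using supp b_pos a_pos by simp
    ultimately show False by blast
  qed
  then have "0 < B" using v0[of 0] by (simp add: B_def)
  have va: "v a = B * cos (\<omega> * a)" "V a = - (\<omega> * B * sin (\<omega> * a))"
    using inner[of a] a_pos by auto
  have BA: "B = A"
    by (rule solution_at_centre[OF \<open>b < 1\<close> cv v0 cV dv dV zero va \<open>0 < B\<close>])
  have u'a: "u' a = - (\<omega> * A * sin (\<omega> * a))" using a_pos by (simp add: u'_def right'_def)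
  have ua: "u a = A * cos (\<omega> * a)" using a_pos by (simp add: u_abs right_def)
  have middle: "v x = u x" if x: "a \<le> x" "x < b" for x
  proof -
    \<comment> \<open>Fixing x < b first gives \<open>u\<close> a positive minimum on [a,x],
      attained at y. The Lipschitz constant \<open>u y powr (\<alpha> - 1)\<close> depends on x, but
      each x is treated separately.\<close>
    have ne: "{a..x} \<noteq> {}" using x by simp
    obtain y where y: "y \<in> {a..x}" "\<And>z. z \<in> {a..x} \<Longrightarrow> u y \<le> u z"
      using continuous_attains_inf[OF compact_Icc ne continuous_u] by blast
    have uy: "0 < u y" using y(1) x a_pos by (intro u_pos) auto
    have sub: "{a..x} \<subseteq> {-1..1}" using x a_pos b_le_1 by auto
    have "v x - u x = 0 \<and> V x - u' x = 0"
    proof (rule second_order_zero[where p = a and q = x and x = x and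
          d = "\<lambda>x. v x - u x" and D = "\<lambda>x. V x - u' x" and L = "lam + u y powr (\<alpha> - 1)"])
      show "continuous_on {a..x} (\<lambda>x. v x - u x)"
        by (intro continuous_on_diff continuous_u continuous_on_subset[OF cv sub])
      show "continuous_on {a..x} (\<lambda>x. V x - u' x)"
        by (intro continuous_on_diff continuous_on_subset[OF cV sub] continuous_on_subset[OF continuous_u'])
          simp
      fix z assume z: "a < z" "z < x"
      then have z1: "z \<in> {-1<..<1}" "\<bar>z\<bar> \<noteq> a" and z2: "z \<notin> {-b, -a, 0, a, b}"
        using x a_pos b_le_1 by auto
      have m: "m_weight n z = -1" using z(1) by (simp add: m_weight_def a_def)
      show "((\<lambda>x. v x - u x) has_real_derivative V z - u' z) (at z)"
        by (intro DERIV_diff dv z1 DERIV_u)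
      show "((\<lambda>x. V x - u' x) has_real_derivative - (lam * v z + m_weight n z * v z powr \<alpha>)
          - - (lam * u z + m_weight n z * u z powr \<alpha>)) (at z)"
        by (intro DERIV_diff dV z1 DERIV_u' z2)
      have "\<bar>v z powr \<alpha> - u z powr \<alpha>\<bar> \<le> u z powr (\<alpha> - 1) * \<bar>v z - u z\<bar>"
        using z1 z x a_pos by (intro abs_powr_diff_le \<alpha> u_pos v0) auto
      also have "\<dots> \<le> u y powr (\<alpha> - 1) * \<bar>v z - u z\<bar>"
        using y(2)[of z] uy \<alpha> z by (intro mult_right_mono powr_mono2') auto
      finally have 1: "\<bar>v z powr \<alpha> - u z powr \<alpha>\<bar> \<le> u y powr (\<alpha> - 1) * \<bar>v z - u z\<bar>" .
      have "- (lam * v z + m_weight n z * v z powr \<alpha>) - - (lam * u z + m_weight n z * u z powr \<alpha>)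
          = (v z powr \<alpha> - u z powr \<alpha>) - lam * (v z - u z)"
        by (simp add: m algebra_simps)
      also have "\<bar>\<dots>\<bar> \<le> \<bar>v z powr \<alpha> - u z powr \<alpha>\<bar> + \<bar>lam * (v z - u z)\<bar>" by (rule abs_triangle_ineq4)
      also have "\<dots> \<le> u y powr (\<alpha> - 1) * \<bar>v z - u z\<bar> + lam * \<bar>v z - u z\<bar>"
        using 1 lam_pos by (simp add: abs_mult)
      finally show "\<bar>- (lam * v z + m_weight n z * v z powr \<alpha>) - - (lam * u z + m_weight n z * u z powr \<alpha>)\<bar>
          \<le> (lam + u y powr (\<alpha> - 1)) * \<bar>v z - u z\<bar>" by (simp add: distrib_right add.commute)
    qed (use va ua u'a BA x lam_pos in auto)
    then show ?thesis by simp
  qed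
  \<comment> \<open>The support gives v = 0 on the open interval (b,1); continuity adds b and
    1.\<close>
  have outside: "v x = 0" if "b \<le> x" "x \<le> 1" for x
  proof (rule continuous_constant_on_closure[where S = "{b<..<1}" and f = v])
    show "continuous_on (closure {b<..<1}) v"
      using \<open>b < 1\<close> b_pos by (auto intro: continuous_on_subset[OF cv])
  qed (use \<open>b < 1\<close> that zero in auto)
  have pos: "v x = u x" if "0 \<le> x" "x \<le> 1" for x
  proof -
    consider "x \<le> a" | "a \<le> x" "x < b" | "b \<le> x" by linarith
    then show ?thesis
    proof cases
      case 1
      then show ?thesis using inner[of x] that BA by (simp add: u_abs right_def)
    next
      case 2
      then show ?thesis by (rule middle)
    next
      case 3
      then show ?thesis using outside that u_eq_0 by simp
    qed
  qed
  show ?thesis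
  proof (cases "0 \<le> x")
    case False
    then have "v (- x) = u (- x)" using x by (intro pos) auto
    then show ?thesis using even x u_even by (simp add: even_on_interval_def)
  qed (use pos x in auto)
qed

end

context flat_profile
begin

section \<open>The formulas in the original parameters\<close>

lemma amplitude: "A = (2 / ((1 + \<alpha>) * lam)) powr (1 / (1 - \<alpha>)) *
    cos (sqrt lam / real n) powr ((1 + \<alpha>) / (1 - \<alpha>))"
  by (simp add: A_def C_def \<omega>_def a_def)

lemma u_inner: "0 \<le> x \<Longrightarrow> x \<le> 1 / real n \<Longrightarrow> u x = A * cos (sqrt lam * x)"
  by (simp add: u_abs right_def a_def \<omega>_def)

lemma u_outer:
  assumes "1 / real n \<le> x" "x \<le> b_end \<alpha> n lam"
  shows "u x = (2 / ((1 + \<alpha>) * lam)) powr (1 / (1 - \<alpha>)) *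
    sin ((1 - \<alpha>) / 2 * sqrt lam * (b_end \<alpha> n lam - x)) powr (2 / (1 - \<alpha>))"
proof -
  have x: "a \<le> x" "x \<le> b" using assms by (simp_all add: a_def b_def)
  then have "u x = outer x"
    using a_pos outer_a by (cases "x = a") (auto simp: u_abs right_def)
  also have "\<dots> = C * sin (\<kappa> * (b - x)) powr p" using x by (simp add: outer_def)
  finally show ?thesis by (simp only: C_def \<kappa>_def b_def p_def \<omega>_def)
qed

end

section \<open>Dependence on the parameters\<close>

text \<open>Both inequalities reduce to 2/n < d < 2 for the denominator d: the upper one from
  \<alpha> < 1 and n \<ge> 2, the lower one from (1-\<alpha>)/n < 1 - \<alpha>.\<close>

lemma lam_c_bounds:
  assumes "0 < \<alpha>" "\<alpha> < 1" "2 \<le> n"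
  shows "pi\<^sup>2 / 4 < lam_c \<alpha> n" "lam_c \<alpha> n < lam_star n"
proof -
  define d where "d = (1 - \<alpha>) + (1 + \<alpha>) / real n"
  have d0: "0 < d" using assms unfolding d_def by (intro add_pos_nonneg) auto
  have "(1 + \<alpha>) / real n \<le> (1 + \<alpha>) / 2" using assms by (intro divide_left_mono) auto
  moreover have "(1 - \<alpha>) + (1 + \<alpha>) / 2 < 2" using assms by (simp add: field_simps)
  ultimately have d2: "d < 2" unfolding d_def by linarith
  have "d\<^sup>2 < 2\<^sup>2" using d0 d2 by (intro power_strict_mono) auto
  then have "pi\<^sup>2 / 2\<^sup>2 < pi\<^sup>2 / d\<^sup>2" using d0 by (intro divide_strict_left_mono) auto
  then show "pi\<^sup>2 / 4 < lam_c \<alpha> n" by (simp add: lam_c_def d_def)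
  have "(1 - \<alpha>) / real n < (1 - \<alpha>) / 1" using assms by (intro divide_strict_left_mono) auto
  then have "(1 - \<alpha>) / real n < 1 - \<alpha>" by (simp only: div_by_1)
  moreover have "(1 - \<alpha>) / real n + (1 + \<alpha>) / real n = 2 / real n"
    by (simp add: add_divide_distrib[symmetric])
  ultimately have "2 / real n < d" unfolding d_def by linarith
  then have "pi / d < pi / (2 / real n)" using assms d0 by (intro divide_strict_left_mono) auto
  then have "pi / d < real n * pi / 2" by (simp add: mult.commute)
  then have "(pi / d)\<^sup>2 < (real n * pi / 2)\<^sup>2" using d0 by (intro power_strict_mono) auto
  then show "lam_c \<alpha> n < lam_star n" by (simp add: lam_c_def lam_star_def d_def power_divide)
qed

lemma sqrt_lam_c:
  assumes "0 < \<alpha>" "\<alpha> < 1" "2 \<le> n"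
  shows "sqrt (lam_c \<alpha> n) / real n = pi / (real n * (1 - \<alpha>) + (1 + \<alpha>))"
proof -
  have d0: "0 < (1 - \<alpha>) + (1 + \<alpha>) / real n" using assms by (intro add_pos_nonneg) auto
  then have "sqrt (lam_c \<alpha> n) = pi / ((1 - \<alpha>) + (1 + \<alpha>) / real n)"
    by (simp add: lam_c_def real_sqrt_divide)
  moreover have "((1 - \<alpha>) + (1 + \<alpha>) / real n) * real n = real n * (1 - \<alpha>) + (1 + \<alpha>)"
    using assms by (simp add: field_simps)
  ultimately show ?thesis by (metis divide_divide_eq_left)
qed

text \<open>Both factors are positive and strictly decreasing as long as the phase stays below pi/2,
  which is what the bound by \<open>lam_star\<close> guarantees.\<close>

lemma amplitude_strict_antimono:
  fixes \<alpha> :: real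
  assumes "0 < \<alpha>" "\<alpha> < 1" "0 < n" "0 < x" "x < y" "y < lam_star n"
  shows "(2 / ((1 + \<alpha>) * y)) powr (1 / (1 - \<alpha>)) * cos (sqrt y / real n) powr ((1 + \<alpha>) / (1 - \<alpha>))
    < (2 / ((1 + \<alpha>) * x)) powr (1 / (1 - \<alpha>)) * cos (sqrt x / real n) powr ((1 + \<alpha>) / (1 - \<alpha>))"
proof (rule mult_strict_mono)
  have "2 / ((1 + \<alpha>) * y) < 2 / ((1 + \<alpha>) * x)"
    using assms by (intro divide_strict_left_mono mult_strict_left_mono) auto
  then show "(2 / ((1 + \<alpha>) * y)) powr (1 / (1 - \<alpha>)) < (2 / ((1 + \<alpha>) * x)) powr (1 / (1 - \<alpha>))"
    using assms by (intro powr_less_mono2) auto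
  have "sqrt y < real n * pi / 2"
    using real_sqrt_less_mono[OF assms(6)] by (simp add: lam_star_def)
  then have y: "sqrt y / real n < pi / 2" using assms by (simp add: field_simps)
  have "sqrt x / real n < sqrt y / real n" using assms by (intro divide_strict_right_mono) auto
  then have "cos (sqrt y / real n) < cos (sqrt x / real n)"
    using assms y pi_gt_zero by (intro cos_monotone_0_pi) (simp, simp, linarith)
  moreover have "0 < cos (sqrt y / real n)"
  proof (rule cos_gt_zero_pi[OF _ y])
    have "0 \<le> sqrt y / real n" using assms by simp
    then show "- (pi / 2) < sqrt y / real n" using pi_gt_zero by linarith
  qed
  ultimately show "cos (sqrt y / real n) powr ((1 + \<alpha>) / (1 - \<alpha>)) < cos (sqrt x / real n) powr ((1 + \<alpha>) / (1 - \<alpha>))"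
    using assms by (intro powr_less_mono2) auto
qed (use assms in auto)

lemma amplitude_tendsto_0:
  fixes \<alpha> :: real
  assumes "0 < \<alpha>" "\<alpha> < 1" "0 < n"
  shows "((\<lambda>x. (2 / ((1 + \<alpha>) * x)) powr (1 / (1 - \<alpha>)) *
    cos (sqrt x / real n) powr ((1 + \<alpha>) / (1 - \<alpha>))) \<longlongrightarrow> 0) (at_left (lam_star n))"
proof -
  let ?l = "lam_star n"
  have l: "0 < ?l" "sqrt ?l / real n = pi / 2" using assms by (auto simp: lam_star_def)
  have "((\<lambda>x. cos (sqrt x / real n)) \<longlongrightarrow> cos (sqrt ?l / real n)) (at_left ?l)"
    using assms by (intro tendsto_intros) auto
  then have "((\<lambda>x. cos (sqrt x / real n)) \<longlongrightarrow> 0) (at_left ?l)" unfolding l(2) by simp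
  \<comment> \<open>A power whose base tends to 0 needs a nonnegative base; the cosine is
    nonnegative on this side of the phase pi/2.\<close>
  moreover have "\<forall>\<^sub>F x in at_left ?l. 0 \<le> cos (sqrt x / real n)"
  proof -
    have "\<forall>\<^sub>F x in at_left ?l. x \<in> {0<..<?l}" by (rule eventually_at_left_real[OF l(1)])
    then show ?thesis
    proof eventually_elim
      case (elim x)
      then have "sqrt x / real n \<le> sqrt ?l / real n" by (intro divide_right_mono) auto
      moreover have "0 \<le> sqrt x / real n" using elim by simp
      ultimately show ?case unfolding l(2) by (intro cos_ge_zero) auto
    qed
  qed
  ultimately have "((\<lambda>x. cos (sqrt x / real n) powr ((1 + \<alpha>) / (1 - \<alpha>))) \<longlongrightarrow> 0) (at_left ?l)"
    using assms by (intro tendsto_zero_powrI[OF _ tendsto_const]) auto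
  moreover have "((\<lambda>x. (2 / ((1 + \<alpha>) * x)) powr (1 / (1 - \<alpha>))) \<longlongrightarrow>
      (2 / ((1 + \<alpha>) * ?l)) powr (1 / (1 - \<alpha>))) (at_left ?l)"
    using assms l(1) by (intro tendsto_intros) auto
  ultimately show ?thesis using tendsto_mult by fastforce
qed

lemma lam_c_tendsto:
  assumes "0 < \<alpha>" "\<alpha> < 1"
  shows "lam_c \<alpha> \<longlonglongrightarrow> pi\<^sup>2 / (1 - \<alpha>)\<^sup>2"
proof -
  have "(\<lambda>n. pi\<^sup>2 / ((1 - \<alpha>) + (1 + \<alpha>) / real n)\<^sup>2) \<longlonglongrightarrow> pi\<^sup>2 / ((1 - \<alpha>) + 0)\<^sup>2"
    using assms by (intro tendsto_intros lim_const_over_n) auto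
  then show ?thesis by (simp add: lam_c_def[abs_def])
qed

lemma lam_c_strict_mono:
  assumes "0 < \<alpha>" "\<alpha> < 1"
  shows "strict_mono_on {2..} (lam_c \<alpha>)"
proof (rule strict_mono_onI)
  fix m n :: nat assume mn: "m \<in> {2..}" "n \<in> {2..}" "m < n"
  have d: "0 < (1 - \<alpha>) + (1 + \<alpha>) / real k" for k :: nat
    using assms by (intro add_pos_nonneg) auto
  have "(1 + \<alpha>) / real n < (1 + \<alpha>) / real m"
    using assms mn by (intro divide_strict_left_mono) auto
  then have "((1 - \<alpha>) + (1 + \<alpha>) / real n)\<^sup>2 < ((1 - \<alpha>) + (1 + \<alpha>) / real m)\<^sup>2"
    using d[of n] by (intro power_strict_mono) auto
  then show "lam_c \<alpha> m < lam_c \<alpha> n"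
    unfolding lam_c_def using d[of m] d[of n] by (intro divide_strict_left_mono) auto
qed

text \<open>\<open>lam_c\<close> converges while \<open>lam_star\<close> grows like n^2.\<close>

lemma lam_ratio_tendsto:
  assumes "0 < \<alpha>" "\<alpha> < 1"
  shows "(\<lambda>n. lam_c \<alpha> n / lam_star n) \<longlonglongrightarrow> 0"
proof -
  have "(\<lambda>n. lam_c \<alpha> n * (4 / pi\<^sup>2) * (1 / real n)\<^sup>2) \<longlonglongrightarrow> pi\<^sup>2 / (1 - \<alpha>)\<^sup>2 * (4 / pi\<^sup>2) * 0\<^sup>2"
    by (intro tendsto_intros lam_c_tendsto assms lim_1_over_n)
  then show ?thesis by (simp add: lam_star_def power_mult_distrib power_divide mult_ac)
qed

text \<open>The phase tends to 0, so the cosine factor tends to 1 and only the limit of the first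
  factor remains.\<close>

lemma critical_amplitude_tendsto:
  assumes "0 < \<alpha>" "\<alpha> < 1"
  shows "(\<lambda>n. (2 / ((1 + \<alpha>) * pi\<^sup>2) * ((1 - \<alpha>) + (1 + \<alpha>) / real n)\<^sup>2) powr (1 / (1 - \<alpha>)) *
      cos (pi / (real n * (1 - \<alpha>) + (1 + \<alpha>))) powr ((1 + \<alpha>) / (1 - \<alpha>)))
    \<longlonglongrightarrow> (2 * (1 - \<alpha>)\<^sup>2 / ((1 + \<alpha>) * pi\<^sup>2)) powr (1 / (1 - \<alpha>))"
proof -
  have "filterlim (\<lambda>n. (1 + \<alpha>) + (1 - \<alpha>) * real n) at_top sequentially"
    using assms
    by (intro filterlim_tendsto_add_at_top[OF tendsto_const] filterlim_real_sequentially
        filterlim_tendsto_pos_mult_at_top[OF tendsto_const]) auto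
  then have "filterlim (\<lambda>n. real n * (1 - \<alpha>) + (1 + \<alpha>)) at_top sequentially"
    by (simp add: add.commute mult.commute)
  then have "(\<lambda>n. pi / (real n * (1 - \<alpha>) + (1 + \<alpha>))) \<longlonglongrightarrow> 0"
    by (intro tendsto_divide_0[OF tendsto_const] filterlim_at_top_imp_at_infinity)
  then have "(\<lambda>n. cos (pi / (real n * (1 - \<alpha>) + (1 + \<alpha>))) powr ((1 + \<alpha>) / (1 - \<alpha>)))
      \<longlonglongrightarrow> cos 0 powr ((1 + \<alpha>) / (1 - \<alpha>))"
    by (intro tendsto_intros) auto
  moreover have "(\<lambda>n. (2 / ((1 + \<alpha>) * pi\<^sup>2) * ((1 - \<alpha>) + (1 + \<alpha>) / real n)\<^sup>2) powr (1 / (1 - \<alpha>)))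
      \<longlonglongrightarrow> (2 / ((1 + \<alpha>) * pi\<^sup>2) * ((1 - \<alpha>) + 0)\<^sup>2) powr (1 / (1 - \<alpha>))"
    using assms by (intro tendsto_intros lim_const_over_n) auto
  ultimately show ?thesis using tendsto_mult by fastforce
qed

theorem theorem7:
  fixes \<alpha> :: real
  assumes "0 < \<alpha>" and "\<alpha> < 1"
  shows "\<exists>(uc :: nat \<Rightarrow> real \<Rightarrow> real) (u :: nat \<Rightarrow> real \<Rightarrow> real \<Rightarrow> real).
    (\<forall>n\<ge>2.
       pi\<^sup>2 / 4 < lam_c \<alpha> n \<and> lam_c \<alpha> n < lam_star n \<and>
       nonneg_solution \<alpha> n (lam_c \<alpha> n) (uc n) \<and> even_on_interval (uc n) \<and> positive_flat (uc n) \<and>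
       (\<forall>lam\<in>{lam_c \<alpha> n<..<lam_star n}.
          nonneg_solution \<alpha> n lam (u n lam) \<and> even_on_interval (u n lam) \<and>
          supp (u n lam) = {- b_end \<alpha> n lam..b_end \<alpha> n lam} \<and>
          {- b_end \<alpha> n lam..b_end \<alpha> n lam} \<subseteq> {-1<..<1} \<and>
          (\<forall>v. nonneg_solution \<alpha> n lam v \<and> even_on_interval v \<and>
               supp v = {- b_end \<alpha> n lam..b_end \<alpha> n lam} \<longrightarrow> (\<forall>x\<in>{-1..1}. v x = u n lam x)) \<and>
          (\<forall>x. 0 \<le> x \<and> x \<le> 1 / real n \<longrightarrow>
               u n lam x = Linf_norm (u n lam) * cos (sqrt lam * x)) \<and>
          (\<forall>x. 1 / real n \<le> x \<and> x \<le> b_end \<alpha> n lam \<longrightarrow>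
               u n lam x = (2 / ((1 + \<alpha>) * lam)) powr (1 / (1 - \<alpha>)) *
                 sin ((1 - \<alpha>) / 2 * sqrt lam * (b_end \<alpha> n lam - x)) powr (2 / (1 - \<alpha>))) \<and>
          (\<forall>x. b_end \<alpha> n lam \<le> x \<and> x \<le> 1 \<longrightarrow> u n lam x = 0) \<and>
          Linf_norm (u n lam) =
            (2 / ((1 + \<alpha>) * lam)) powr (1 / (1 - \<alpha>)) *
            cos (sqrt lam / real n) powr ((1 + \<alpha>) / (1 - \<alpha>)) \<and>
          H lam (u n lam) = M \<alpha> n (u n lam) \<and> M \<alpha> n (u n lam) < 0 \<and>
          E \<alpha> n lam (u n lam) > 0 \<and> E'' \<alpha> n lam (u n lam) < 0) \<and>
       strict_antimono_on {lam_c \<alpha> n<..<lam_star n} (\<lambda>lam. Linf_norm (u n lam)) \<and>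
       ((\<lambda>lam. Linf_norm (u n lam)) \<longlongrightarrow> 0) (at_left (lam_star n)) \<and>
       Linf_norm (uc n) =
         (2 / ((1 + \<alpha>) * pi\<^sup>2) * ((1 - \<alpha>) + (1 + \<alpha>) / real n)\<^sup>2) powr (1 / (1 - \<alpha>)) *
         cos (pi / (real n * (1 - \<alpha>) + (1 + \<alpha>))) powr ((1 + \<alpha>) / (1 - \<alpha>))) \<and>
    strict_mono_on {2..} (lam_c \<alpha>) \<and>
    lam_c \<alpha> \<longlonglongrightarrow> pi\<^sup>2 / (1 - \<alpha>)\<^sup>2 \<and>
    (\<lambda>n. Linf_norm (uc n)) \<longlonglongrightarrow> (2 * (1 - \<alpha>)\<^sup>2 / ((1 + \<alpha>) * pi\<^sup>2)) powr (1 / (1 - \<alpha>)) \<and>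
    (2 * (1 - \<alpha>)\<^sup>2 / ((1 + \<alpha>) * pi\<^sup>2)) powr (1 / (1 - \<alpha>)) > 0 \<and>
    (\<lambda>n. lam_c \<alpha> n / lam_star n) \<longlonglongrightarrow> 0"
proof -
  define w where "w n lam = flat_profile.u \<alpha> n lam" for n lam
  \<comment> \<open>The critical solution is the same profile at the closed end of the locale's
    range, so one norm formula serves both families.\<close>
  define uc where "uc n = w n (lam_c \<alpha> n)" for n
  define Ac where "Ac n = (2 / ((1 + \<alpha>) * pi\<^sup>2) * ((1 - \<alpha>) + (1 + \<alpha>) / real n)\<^sup>2) powr (1 / (1 - \<alpha>)) *
      cos (pi / (real n * (1 - \<alpha>) + (1 + \<alpha>))) powr ((1 + \<alpha>) / (1 - \<alpha>))" for n
  have profile: "flat_profile \<alpha> n lam" if "2 \<le> n" "lam_c \<alpha> n \<le> lam" "lam < lam_star n" for n lam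
    by unfold_locales (use assms that in auto)
  have norm: "Linf_norm (w n lam) = (2 / ((1 + \<alpha>) * lam)) powr (1 / (1 - \<alpha>)) *
      cos (sqrt lam / real n) powr ((1 + \<alpha>) / (1 - \<alpha>))"
    if "2 \<le> n" "lam_c \<alpha> n \<le> lam" "lam < lam_star n" for n lam
    using flat_profile.Linf_u[OF profile[OF that]] flat_profile.amplitude[OF profile[OF that]]
    by (simp add: w_def)
  note bounds = lam_c_bounds[OF assms]
  have norm_c: "Linf_norm (uc n) = Ac n" if "2 \<le> n" for n
  proof -
    have "2 / ((1 + \<alpha>) * lam_c \<alpha> n) = 2 / ((1 + \<alpha>) * pi\<^sup>2) * ((1 - \<alpha>) + (1 + \<alpha>) / real n)\<^sup>2"
      by (simp add: lam_c_def)
    then show ?thesis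
      using norm[OF that order.refl bounds(2)[OF that]] sqrt_lam_c[OF assms that]
      by (simp add: uc_def Ac_def)
  qed
  have solutions: "nonneg_solution \<alpha> n lam (w n lam) \<and> even_on_interval (w n lam) \<and>
          supp (w n lam) = {- b_end \<alpha> n lam..b_end \<alpha> n lam} \<and>
          {- b_end \<alpha> n lam..b_end \<alpha> n lam} \<subseteq> {-1<..<1} \<and>
          (\<forall>v. nonneg_solution \<alpha> n lam v \<and> even_on_interval v \<and>
               supp v = {- b_end \<alpha> n lam..b_end \<alpha> n lam} \<longrightarrow> (\<forall>x\<in>{-1..1}. v x = w n lam x)) \<and>
          (\<forall>x. 0 \<le> x \<and> x \<le> 1 / real n \<longrightarrow>
               w n lam x = Linf_norm (w n lam) * cos (sqrt lam * x)) \<and>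
          (\<forall>x. 1 / real n \<le> x \<and> x \<le> b_end \<alpha> n lam \<longrightarrow>
               w n lam x = (2 / ((1 + \<alpha>) * lam)) powr (1 / (1 - \<alpha>)) *
                 sin ((1 - \<alpha>) / 2 * sqrt lam * (b_end \<alpha> n lam - x)) powr (2 / (1 - \<alpha>))) \<and>
          (\<forall>x. b_end \<alpha> n lam \<le> x \<and> x \<le> 1 \<longrightarrow> w n lam x = 0) \<and>
          Linf_norm (w n lam) =
            (2 / ((1 + \<alpha>) * lam)) powr (1 / (1 - \<alpha>)) *
            cos (sqrt lam / real n) powr ((1 + \<alpha>) / (1 - \<alpha>)) \<and>
          H lam (w n lam) = M \<alpha> n (w n lam) \<and> M \<alpha> n (w n lam) < 0 \<and>
          E \<alpha> n lam (w n lam) > 0 \<and> E'' \<alpha> n lam (w n lam) < 0"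
    if two: "2 \<le> n" and range: "lam \<in> {lam_c \<alpha> n<..<lam_star n}" for n lam
  proof -
    interpret flat_profile \<alpha> n lam using profile two range by simp
    have b1: "b < 1" by (rule b_less_1) (use range in simp)
    show ?thesis
    proof (intro conjI allI impI ballI)
      show "nonneg_solution \<alpha> n lam (w n lam)" unfolding w_def by (rule u_solution)
      show "even_on_interval (w n lam)" by (simp add: w_def even_on_interval_def u_even)
      show "supp (w n lam) = {- b_end \<alpha> n lam..b_end \<alpha> n lam}"
        using supp_u by (simp add: w_def b_def)
      show "{- b_end \<alpha> n lam..b_end \<alpha> n lam} \<subseteq> {-1<..<1}"
        using b1 by (auto simp: b_def)
      show "v x = w n lam x" if "nonneg_solution \<alpha> n lam v \<and> even_on_interval v \<and>
          supp v = {- b_end \<alpha> n lam..b_end \<alpha> n lam}" "x \<in> {-1..1}" for v x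
        unfolding w_def by (rule solution_unique[OF b1]) (use that in \<open>simp_all add: b_def\<close>)
      show "w n lam x = Linf_norm (w n lam) * cos (sqrt lam * x)" if "0 \<le> x \<and> x \<le> 1 / real n" for x
        using that by (simp add: w_def Linf_u u_inner)
      show "w n lam x = (2 / ((1 + \<alpha>) * lam)) powr (1 / (1 - \<alpha>)) *
                 sin ((1 - \<alpha>) / 2 * sqrt lam * (b_end \<alpha> n lam - x)) powr (2 / (1 - \<alpha>))"
        if "1 / real n \<le> x \<and> x \<le> b_end \<alpha> n lam" for x
        unfolding w_def by (rule u_outer) (use that in auto)
      show "w n lam x = 0" if "b_end \<alpha> n lam \<le> x \<and> x \<le> 1" for x
        unfolding w_def using that b_pos by (intro u_eq_0) (simp add: b_def)
      show "Linf_norm (w n lam) = (2 / ((1 + \<alpha>) * lam)) powr (1 / (1 - \<alpha>)) *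
            cos (sqrt lam / real n) powr ((1 + \<alpha>) / (1 - \<alpha>))"
        by (rule norm) (use two range in auto)
    qed (simp_all only: w_def H_u_eq_M M_u_neg E_u_pos E''_u_neg)
  qed
  have critical: "nonneg_solution \<alpha> n (lam_c \<alpha> n) (uc n) \<and> even_on_interval (uc n) \<and> positive_flat (uc n)"
    if n: "2 \<le> n" for n
  proof -
    interpret flat_profile \<alpha> n "lam_c \<alpha> n" using profile n bounds by simp
    show ?thesis
      using u_solution u_even u_positive_flat by (simp add: uc_def w_def even_on_interval_def)
  qed
  have anti: "strict_antimono_on {lam_c \<alpha> n<..<lam_star n} (\<lambda>lam. Linf_norm (w n lam))" if n: "2 \<le> n" for n
  proof (rule monotone_onI)
    fix x y assume xy: "x \<in> {lam_c \<alpha> n<..<lam_star n}" "y \<in> {lam_c \<alpha> n<..<lam_star n}" "x < y"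
    have "0 < x" using xy(1) flat_profile.lam_pos[OF profile[OF n, of x]] by simp
    then show "Linf_norm (w n y) < Linf_norm (w n x)"
      using xy n assms amplitude_strict_antimono[of \<alpha> n x y] by (simp add: norm)
  qed
  have lim0: "((\<lambda>lam. Linf_norm (w n lam)) \<longlongrightarrow> 0) (at_left (lam_star n))" if n: "2 \<le> n" for n
  proof (rule Lim_transform_eventually)
    show "((\<lambda>x. (2 / ((1 + \<alpha>) * x)) powr (1 / (1 - \<alpha>)) *
      cos (sqrt x / real n) powr ((1 + \<alpha>) / (1 - \<alpha>))) \<longlongrightarrow> 0) (at_left (lam_star n))"
      by (rule amplitude_tendsto_0) (use assms n in auto)
    show "\<forall>\<^sub>F x in at_left (lam_star n). (2 / ((1 + \<alpha>) * x)) powr (1 / (1 - \<alpha>)) *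
      cos (sqrt x / real n) powr ((1 + \<alpha>) / (1 - \<alpha>)) = Linf_norm (w n x)"
      using eventually_at_left_real[OF bounds(2)[OF n]]
      by eventually_elim (use n in \<open>simp add: norm\<close>)
  qed
  \<comment> \<open>The norm formula is available from n = 2 on, so the two sequences are compared
    eventually.\<close>
  have lim_c: "(\<lambda>n. Linf_norm (uc n)) \<longlonglongrightarrow> (2 * (1 - \<alpha>)\<^sup>2 / ((1 + \<alpha>) * pi\<^sup>2)) powr (1 / (1 - \<alpha>))"
    using critical_amplitude_tendsto[OF assms]
    by (rule Lim_transform_eventually)
      (use norm_c in \<open>auto simp: Ac_def eventually_sequentially intro!: exI[of _ 2]\<close>)
  have pos: "(2 * (1 - \<alpha>)\<^sup>2 / ((1 + \<alpha>) * pi\<^sup>2)) powr (1 / (1 - \<alpha>)) > 0"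
    using assms by simp
  show ?thesis
    by (intro exI[of _ uc] exI[of _ w] conjI allI impI;
      (erule bounds | erule critical[THEN conjunct1] | erule critical[THEN conjunct2, THEN conjunct1]
        | erule critical[THEN conjunct2, THEN conjunct2] | (rule ballI, erule solutions, assumption)
        | erule anti | erule lim0 | erule norm_c[unfolded Ac_def]
        | rule lam_c_strict_mono assms lam_c_tendsto lim_c pos lam_ratio_tendsto)+)
qed

end
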